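(* Let $f\in\mathcal{M}_S$ and let $J$ be a Julia component of $f$. Then there are only finitely many Herman rings of $f$ having a boundary component contained in $J$.
   Context: A general transcendental meromorphic function is a meromorphic function $f:\mathbb{C}\to\widehat{\mathbb{C}}$ whose only essential singularity is at $\infty$ and which has either at least two poles or exactly one pole that is not an omitted value. The Fatou set is the set of points having a neighbourhood on which all iterates $f^n$ are defined and normal; the Julia set $\mathcal{J}(f)$ is its complement. A Julia component is a maximal connected subset of the Julia set. An omitted value is $b\in\mathbb{C}$ with $f(z)\neq b$ for all $z\in\mathbb{C}$. A Baker omitted value (bov) is an omitted value $b$ for which there is a disk $D$ centred at $b$ such that each component of the boundary of $f^{-1}(D)$ is bounded; it is stable if all iterates $f^n$ are defined (analytic) in a neighbourhood of $b$. $\mathcal{M}_S$ denotes the class of general transcendental meromorphic functions having a stable bov. A $p$-periodic Fatou component $V$ is a Herman ring if there is a conformal map $\phi:V\to\{1<|z|<r\}$ with $\phi\circ f^p\circ\phi^{-1}(z)=e^{2\pi i\theta}z$ for some irrational $\theta$. *)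

theory Defs
  imports "HOL-Complex_Analysis.Complex_Analysis" "HOL-Computational_Algebra.Polynomial"
begin

text \<open>A meromorphic function f on C is represented by a total function
complex => complex; its poles are the points where it tends to infinity.
Off the pole set it must be holomorphic, and the pole set is discrete.\<close>

definition poles :: "(complex \<Rightarrow> complex) \<Rightarrow> complex set" where
  "poles f = {z. is_pole f z}"

definition meromorphic_plane :: "(complex \<Rightarrow> complex) \<Rightarrow> bool" where
  "meromorphic_plane f \<longleftrightarrow>
     (\<forall>z. \<not> z islimpt poles f) \<and> f holomorphic_on (UNIV - poles f)"

definition rational_fun :: "(complex \<Rightarrow> complex) \<Rightarrow> bool" where
  "rational_fun f \<longleftrightarrow>
     (\<exists>p q :: complex poly. q \<noteq> 0 \<and>
        (\<forall>z. z \<notin> poles f \<and> poly q z \<noteq> 0 \<longrightarrow> f z = poly p z / poly q z))"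

text \<open>Transcendental: infinity is an essential singularity, i.e. f is not rational.\<close>
definition transcendental_meromorphic :: "(complex \<Rightarrow> complex) \<Rightarrow> bool" where
  "transcendental_meromorphic f \<longleftrightarrow> meromorphic_plane f \<and> \<not> rational_fun f"

definition omitted_value :: "(complex \<Rightarrow> complex) \<Rightarrow> complex \<Rightarrow> bool" where
  "omitted_value f b \<longleftrightarrow> (\<forall>z. z \<notin> poles f \<longrightarrow> f z \<noteq> b)"

definition general_transcendental_meromorphic :: "(complex \<Rightarrow> complex) \<Rightarrow> bool" where
  "general_transcendental_meromorphic f \<longleftrightarrow>
     transcendental_meromorphic f \<and>
     ((\<exists>p1 p2. p1 \<in> poles f \<and> p2 \<in> poles f \<and> p1 \<noteq> p2) \<or>
      (\<exists>p. poles f = {p} \<and> \<not> omitted_value f p))"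

definition baker_omitted_value :: "(complex \<Rightarrow> complex) \<Rightarrow> complex \<Rightarrow> bool" where
  "baker_omitted_value f b \<longleftrightarrow> omitted_value f b \<and>
     (\<exists>r>0. \<forall>x \<in> frontier {z. z \<notin> poles f \<and> f z \<in> ball b r}.
        bounded (connected_component_set (frontier {z. z \<notin> poles f \<and> f z \<in> ball b r}) x))"

text \<open>f^n is analytic near z iff none of z, f z, ..., f^(n-1) z near z is a pole.\<close>
definition stable_bov :: "(complex \<Rightarrow> complex) \<Rightarrow> complex \<Rightarrow> bool" where
  "stable_bov f b \<longleftrightarrow> baker_omitted_value f b \<and>
     (\<forall>n. \<exists>e>0. \<forall>z \<in> ball b e. \<forall>k<n. (f ^^ k) z \<notin> poles f)"

definition class_MS :: "(complex \<Rightarrow> complex) \<Rightarrow> bool" where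
  "class_MS f \<longleftrightarrow> general_transcendental_meromorphic f \<and> (\<exists>b. stable_bov f b)"

text \<open>The Riemann sphere is the unit sphere in R^3; the chordal metric is the
Euclidean metric on it. The point at infinity is the north pole.\<close>

definition stereo :: "complex \<Rightarrow> real \<times> real \<times> real" where
  "stereo z = (2 * Re z / ((cmod z)\<^sup>2 + 1), 2 * Im z / ((cmod z)\<^sup>2 + 1),
               ((cmod z)\<^sup>2 - 1) / ((cmod z)\<^sup>2 + 1))"

definition north :: "real \<times> real \<times> real" where
  "north = (0, 0, 1)"

text \<open>Normality of a family (indexed by nat) of maps into the sphere on U: every
sequence in the family has a subsequence converging locally uniformly in the
chordal metric (limit possibly the constant infinity).\<close>
definition normal_family_on :: "complex set \<Rightarrow> (nat \<Rightarrow> complex \<Rightarrow> complex) \<Rightarrow> bool" where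
  "normal_family_on U F \<longleftrightarrow>
     (\<forall>\<sigma> :: nat \<Rightarrow> nat. \<exists>r g. strict_mono r \<and>
        (\<forall>K. compact K \<and> K \<subseteq> U \<longrightarrow>
           uniform_limit K (\<lambda>k. stereo \<circ> F (\<sigma> (r k))) g sequentially))"

definition fatou_set :: "(complex \<Rightarrow> complex) \<Rightarrow> complex set" where
  "fatou_set f = {z. \<exists>U. open U \<and> z \<in> U \<and>
      (\<forall>w\<in>U. \<forall>k. (f ^^ k) w \<notin> poles f) \<and>
      normal_family_on U (\<lambda>n. f ^^ n)}"

definition julia_sphere :: "(complex \<Rightarrow> complex) \<Rightarrow> (real \<times> real \<times> real) set" where
  "julia_sphere f = insert north (stereo ` (UNIV - fatou_set f))"

definition julia_component :: "(complex \<Rightarrow> complex) \<Rightarrow> (real \<times> real \<times> real) set \<Rightarrow> bool" where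
  "julia_component f J \<longleftrightarrow>
     (\<exists>x \<in> julia_sphere f. J = connected_component_set (julia_sphere f) x)"

definition fatou_component :: "(complex \<Rightarrow> complex) \<Rightarrow> complex set \<Rightarrow> bool" where
  "fatou_component f V \<longleftrightarrow>
     (\<exists>z \<in> fatou_set f. V = connected_component_set (fatou_set f) z)"

definition herman_ring :: "(complex \<Rightarrow> complex) \<Rightarrow> complex set \<Rightarrow> bool" where
  "herman_ring f V \<longleftrightarrow> fatou_component f V \<and>
     (\<exists>p::nat. p > 0 \<and> (f ^^ p) ` V \<subseteq> V \<and>
        (\<exists>\<phi> (r::real) (\<theta>::real). r > 1 \<and> \<theta> \<notin> \<rat> \<and>
           \<phi> holomorphic_on V \<and> bij_betw \<phi> V {w. 1 < cmod w \<and> cmod w < r} \<and>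
           (\<forall>w. 1 < cmod w \<and> cmod w < r \<longrightarrow>
              \<phi> ((f ^^ p) (inv_into V \<phi> w)) = exp (2 * pi * \<i> * of_real \<theta>) * w)))"

definition sphere_boundary :: "complex set \<Rightarrow> (real \<times> real \<times> real) set" where
  "sphere_boundary V = closure (stereo ` V) - stereo ` V"

definition boundary_component :: "complex set \<Rightarrow> (real \<times> real \<times> real) set \<Rightarrow> bool" where
  "boundary_component V C \<longleftrightarrow>
     (\<exists>y \<in> sphere_boundary V. C = connected_component_set (sphere_boundary V) y)"

end

(* A meromorphic function f with an omitted value b has no Herman rings at all, so the set in
   question is empty.

   Put g = 1/(f - b), an entire function. If C is an invariant curve of a Herman ring, then g is
   injective on C, hence inside C, so f maps the inside of C univalently either onto the inside of
   f(C), or, if it contains a pole, onto the outside of f(C) together with infinity; in the latter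
   case b lies inside f(C). Take one invariant curve in each ring of the cycle. By normality some
   curve surrounds a pole, so some curve surrounds b; let D be the inside of the outermost such
   curve and F the first iterate of f with a pole in D. It maps D univalently onto the complement
   of a closed disc E_0 inside D. Let E_i = F^i(E_0), as long as E_0, ..., E_(i-1) lie in D and
   contain no pole of F.
   If some E_m in D contains the pole of F, then F maps D minus E_0, ..., E_m into itself, so this
   set is in the Fatou set and D lies in one Fatou component, which is absurd.
   Otherwise some E_M lies outside D. Then G = F^(-1) maps the complement of E_0, ..., E_M into its
   intersection with D. The images of the outer part of the ring around D under the iterates of G
   are disjoint, so all limits of these iterates are constant on the ring. But by the argument
   principle the iterated images of the invariant curve keep winding around one of the E_i, so
   they cannot shrink to a point. *)

theory Submission
  imports Defs
begin

section \<open>Winding numbers of image curves\<close>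

lemma winding_number_comp_holomorphic:
  assumes "f holomorphic_on S" "open S" "valid_path \<gamma>" "path_image \<gamma> \<subseteq> S"
    and "z \<notin> f ` path_image \<gamma>"
  shows "winding_number (f \<circ> \<gamma>) z =
           1 / (2 * pi * \<i>) * contour_integral \<gamma> (\<lambda>w. deriv f w / (f w - z))"
proof -
  have "winding_number (f \<circ> \<gamma>) z =
          1 / (2 * pi * \<i>) * contour_integral (f \<circ> \<gamma>) (\<lambda>w. 1 / (w - z))"
    using assms by (intro winding_number_valid_path)
      (auto intro: valid_path_compose_holomorphic simp: path_image_compose)
  also have "contour_integral (f \<circ> \<gamma>) (\<lambda>w. 1 / (w - z)) =
               contour_integral \<gamma> (\<lambda>w. deriv f w * (1 / (f w - z)))"
    using assms by (intro contour_integral_comp_analyticW) (auto simp: analytic_on_open)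
  finally show ?thesis
    by (simp add: o_def)
qed

text \<open>The logarithmic derivative of \<open>f - z\<close> is holomorphic on the simply
  connected \<open>S\<close>, so Cauchy's theorem makes its integral vanish.\<close>

lemma winding_number_comp_eq_zero:
  assumes "f holomorphic_on S" "open S" "simply_connected S" "valid_path \<gamma>" "path_image \<gamma> \<subseteq> S"
    and "pathfinish \<gamma> = pathstart \<gamma>" "z \<notin> f ` S"
  shows "winding_number (f \<circ> \<gamma>) z = 0"
proof -
  have "((\<lambda>w. deriv f w / (f w - z)) has_contour_integral 0) \<gamma>"
    using assms by (intro Cauchy_theorem_simply_connected[of S])
      (auto intro!: holomorphic_intros holomorphic_deriv)
  then show ?thesis
    using winding_number_comp_holomorphic[of f S \<gamma> z] assms contour_integral_unique by fastforce
qed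

text \<open>By injectivity \<open>f w - f p\<close> is \<open>w - p\<close> times a zero-free
  holomorphic \<open>h\<close>, and only the first factor contributes to the integral of the
  logarithmic derivative.\<close>

lemma winding_number_comp_injective:
  assumes hol: "f holomorphic_on S" and S: "open S" "simply_connected S" and inj: "inj_on f S"
    and \<gamma>: "valid_path \<gamma>" "path_image \<gamma> \<subseteq> S - {p}" "pathfinish \<gamma> = pathstart \<gamma>" and p: "p \<in> S"
  shows "winding_number (f \<circ> \<gamma>) (f p) = winding_number \<gamma> p"
proof -
  define h where "h = (\<lambda>z. if z = p then deriv f p else (f z - f p) / (z - p))"
  have h_hol: "h holomorphic_on S"
  proof -
    have 1: "(\<lambda>z. f z - f p) holomorphic_on S"
      using hol by (intro holomorphic_intros)
    show ?thesis
      by (rule pole_theorem_open_0[OF 1 S(1)]) 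
        (use hol p S in \<open>auto simp: h_def holomorphic_on_imp_differentiable_at\<close>)
  qed
  \<comment> \<open>Away from \<open>p\<close> this is injectivity; at \<open>p\<close> it is the
    non-vanishing derivative of a univalent function.\<close>
  have h_nz: "h z \<noteq> 0" if "z \<in> S" for z
    using that inj p holomorphic_injective_imp_regular[OF hol S(1) inj p]
    by (auto simp: h_def inj_on_def)
  have eq: "deriv f w / (f w - f p) = 1 / (w - p) + deriv h w / h w" if w: "w \<in> S" "w \<noteq> p" for w
  proof -
    have "(h has_field_derivative deriv h w) (at w)"
      using h_hol S w by (simp add: holomorphic_derivI)
    then have "((\<lambda>z. (z - p) * h z + f p) has_field_derivative h w + (w - p) * deriv h w) (at w)"
      by (auto intro!: derivative_eq_intros)
    moreover have "(z - p) * h z + f p = f z" for z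
      by (auto simp: h_def)
    ultimately have "deriv f w = h w + (w - p) * deriv h w"
      by (simp add: DERIV_imp_deriv)
    moreover have "f w - f p = (w - p) * h w"
      using w by (auto simp: h_def)
    ultimately show ?thesis
      using w h_nz[of w] by (simp add: divide_simps)
  qed
  have I1: "((\<lambda>w. 1 / (w - p)) has_contour_integral (2 * pi * \<i> * winding_number \<gamma> p)) \<gamma>"
    using \<gamma> by (intro has_contour_integral_winding_number) auto
  have I2: "((\<lambda>w. deriv h w / h w) has_contour_integral 0) \<gamma>"
    using assms h_hol h_nz by (intro Cauchy_theorem_simply_connected[of S])
      (auto intro!: holomorphic_intros holomorphic_deriv)
  have "((\<lambda>w. deriv f w / (f w - f p)) has_contour_integral (2 * pi * \<i> * winding_number \<gamma> p + 0)) \<gamma>"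
    by (rule has_contour_integral_eq[OF has_contour_integral_add[OF I1 I2]])
      (subst eq, use \<gamma> in auto)
  moreover have "f p \<notin> f ` path_image \<gamma>"
    using inj p \<gamma> by (auto simp: inj_on_def)
  ultimately show ?thesis
    using winding_number_comp_holomorphic[of f S \<gamma> "f p"] assms
    by (simp add: contour_integral_unique subset_Diff_insert)
qed

text \<open>For the inversion \<open>T\<close> at \<open>b\<close>, the function
  \<open>T w - T y\<close> has a simple zero at \<open>y\<close> and a simple pole at
  \<open>b\<close>, so its logarithmic derivative is
  \<open>1 / (w - y) - 1 / (w - b)\<close>.\<close>

lemma winding_number_inverse:
  assumes \<gamma>: "valid_path \<gamma>" "pathfinish \<gamma> = pathstart \<gamma>"
    and b: "b \<notin> path_image \<gamma>" and y: "y \<notin> path_image \<gamma>" "y \<noteq> b"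
  shows "winding_number ((\<lambda>z. 1 / (z - b)) \<circ> \<gamma>) (1 / (y - b)) =
           winding_number \<gamma> y - winding_number \<gamma> b"
proof -
  let ?T = "\<lambda>z. 1 / (z - b)"
  have hol: "?T holomorphic_on (- {b})"
    by (auto intro!: holomorphic_intros)
  have I: "((\<lambda>w. 1 / (w - y) - 1 / (w - b)) has_contour_integral
       (2 * pi * \<i> * winding_number \<gamma> y - 2 * pi * \<i> * winding_number \<gamma> b)) \<gamma>"
    using \<gamma> b y by (intro has_contour_integral_diff has_contour_integral_winding_number) auto
  have "deriv ?T w / (?T w - ?T y) = 1 / (w - y) - 1 / (w - b)" if w: "w \<in> path_image \<gamma>" for w
  proof -
    have ne: "w \<noteq> b" "w \<noteq> y" "y \<noteq> b"
      using w b y by blast+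
    have "(?T has_field_derivative - 1 / (w - b)\<^sup>2) (at w)"
      using ne by (auto intro!: derivative_eq_intros simp: power2_eq_square)
    then have "deriv ?T w = - 1 / (w - b)\<^sup>2"
      by (rule DERIV_imp_deriv)
    moreover have "?T w - ?T y = (y - w) / ((w - b) * (y - b))"
      using ne by (simp add: divide_simps)
    moreover have "- 1 / (w - b)\<^sup>2 / ((y - w) / ((w - b) * (y - b))) = (y - b) / ((w - b) * (w - y))"
      using ne by (simp add: divide_simps power2_eq_square) (simp add: algebra_simps)
    moreover have "1 / (w - y) - 1 / (w - b) = (y - b) / ((w - b) * (w - y))"
      using ne by (simp add: divide_simps)
    ultimately show ?thesis
      by simp
  qed
  then have "((\<lambda>w. deriv ?T w / (?T w - ?T y)) has_contour_integral
       (2 * pi * \<i> * winding_number \<gamma> y - 2 * pi * \<i> * winding_number \<gamma> b)) \<gamma>"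
    by (intro has_contour_integral_eq[OF I]) auto
  note I' = contour_integral_unique[OF this]
  have "?T y \<notin> ?T ` path_image \<gamma>"
    using b y by auto
  moreover have "path_image \<gamma> \<subseteq> - {b}" "open (- {b})"
    using b by auto
  ultimately have "winding_number (?T \<circ> \<gamma>) (?T y) = 1 / (2 * pi * \<i>) *
      (2 * pi * \<i> * winding_number \<gamma> y - 2 * pi * \<i> * winding_number \<gamma> b)"
    using winding_number_comp_holomorphic[OF hol _ \<gamma>(1), of "?T y"] unfolding I' by blast
  also have "\<dots> = winding_number \<gamma> y - winding_number \<gamma> b"
    by (simp add: right_diff_distrib)
  finally show ?thesis .
qed

lemma simple_path_comp_injective:
  assumes "simple_path \<gamma>" "continuous_on (path_image \<gamma>) g" "inj_on g (path_image \<gamma>)"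
  shows "simple_path (g \<circ> \<gamma>)"
  using assms unfolding simple_path_def loop_free_def
  by (auto intro!: path_continuous_image simp: inj_on_def path_image_def)

text \<open>The winding numbers of the image curve count preimages with multiplicity, and for a simple
closed image curve they are 0 or 1 up to sign.\<close>

lemma entire_inj_inside:
  assumes g: "g holomorphic_on UNIV"
    and \<gamma>: "valid_path \<gamma>" "simple_path \<gamma>" "pathfinish \<gamma> = pathstart \<gamma>"
    and inj: "inj_on g (path_image \<gamma>)"
  shows "inj_on g (inside (path_image \<gamma>))"
    and "g ` inside (path_image \<gamma>) = inside (g ` path_image \<gamma>)"
proof -
  let ?C = "path_image \<gamma>"
  define I where "I = inside ?C"
  note J = Jordan_inside_outside[OF \<gamma>(2,3), folded I_def]
  have contg: "continuous_on X g" for X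
    using g by (meson holomorphic_on_imp_continuous_on continuous_on_subset top_greatest)
  have sp: "simple_path (g \<circ> \<gamma>)"
    using \<gamma> contg inj by (intro simple_path_comp_injective)
  have cl: "pathfinish (g \<circ> \<gamma>) = pathstart (g \<circ> \<gamma>)"
    using \<gamma> by (simp add: pathfinish_def pathstart_def)
  have pim: "path_image (g \<circ> \<gamma>) = g ` ?C"
    by (simp add: path_image_compose)
  note Jg = Jordan_inside_outside[OF sp cl, unfolded pim]
  have nonconst: "\<not> g constant_on UNIV"
  proof
    assume "g constant_on UNIV"
    then obtain c where "\<And>z. g z = c"
      by (auto simp: constant_on_def)
    moreover have "\<gamma> 0 \<noteq> \<gamma> (1/2)"
      using \<gamma>(2)[unfolded simple_path_def loop_free_def, THEN conjunct2, rule_format, of 0 "1/2"] by auto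
    ultimately show False
      using inj by (auto simp: inj_on_def path_image_def)
  qed
  have "bounded (?C \<union> I)"
    using J \<gamma> by (simp add: bounded_simple_path_image)
  then obtain r where r: "?C \<union> I \<subseteq> ball 0 r" "r > 0"
    by (meson bounded_subset_ballD)
  \<comment> \<open>Domain for the argument principle. It may contain zeros of \<open>g - a\<close>
    outside the curve, but these have winding number zero.\<close>
  define B where "B = ball (0::complex) r"
  define Z where "Z = (\<lambda>a. {w\<in>I. g w = a})"
  have finZ: "finite {w\<in>B. g w = a}" for a
  proof -
    have "finite {w\<in>cball 0 r. g w - a = 0}"
    proof (rule holomorphic_compact_finite_zeros[of _ UNIV])
      show "\<not> (\<lambda>w. g w - a) constant_on UNIV"
        using nonconst by (auto simp: constant_on_def) (metis diff_add_cancel)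
    qed (auto intro!: holomorphic_intros g)
    then show ?thesis
      by (rule finite_subset[rotated]) (auto simp: B_def)
  qed
  have fin_Z: "finite (Z a)" for a
    by (rule finite_subset[OF _ finZ[of a]]) (use r in \<open>auto simp: Z_def B_def\<close>)
  obtain \<epsilon> :: complex where \<epsilon>: "\<epsilon> \<in> {1, -1}" "\<And>z. z \<in> I \<Longrightarrow> winding_number \<gamma> z = \<epsilon>"
    using simple_closed_path_winding_number_inside[OF \<gamma>(2)] unfolding I_def by (metis insertI1 insertI2)
  have freq: "frequently (\<lambda>w. g w - a \<noteq> 0) (at z)" for a z
  proof (rule ccontr)
    assume "\<not> frequently (\<lambda>w. g w - a \<noteq> 0) (at z)"
    then have "eventually (\<lambda>w. g w = a) (at z)"
      by (simp add: frequently_def)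
    then obtain S where S: "open S" "z \<in> S" "\<And>w. w \<in> S \<Longrightarrow> w \<noteq> z \<Longrightarrow> g w = a"
      by (auto simp: eventually_at_topological)
    have "g constant_on UNIV"
    proof (rule analytic_continuation'[OF g, of "S - {z}" z])
      show "z islimpt S - {z}"
        using S by (metis islimpt_punctured interior_limit_point interior_open)
    qed (use S in \<open>auto simp: constant_on_def\<close>)
    with nonconst show False ..
  qed
  \<comment> \<open>Argument principle for \<open>g - a\<close>: all zeros inside the curve carry
    the same weight \<epsilon>, the orientation of the curve.\<close>
  have count: "winding_number (g \<circ> \<gamma>) a = \<epsilon> * of_int (\<Sum>p\<in>Z a. zorder (\<lambda>w. g w - a) p)"
    if a: "a \<notin> g ` ?C" for a
  proof -
    have "contour_integral \<gamma> (\<lambda>x. deriv (\<lambda>w. g w - a) x * 1 / (g x - a)) = 2 * pi * \<i> *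
       (\<Sum>p\<in>{w \<in> B. g w - a = 0 \<or> w \<in> {}}. winding_number \<gamma> p * 1 * zorder (\<lambda>w. g w - a) p)"
    proof (rule argument_principle)
      show "\<forall>z. z \<notin> B \<longrightarrow> winding_number \<gamma> z = 0"
        using \<gamma> r by (auto simp: B_def intro!: winding_number_zero_outside[of _ "ball 0 r"]
            simp: simple_path_imp_path)
      show "finite {w \<in> B. g w - a = 0 \<or> w \<in> {}}"
        using finZ[of a] by simp
      show "path_image \<gamma> \<subseteq> B - {w \<in> B. g w - a = 0 \<or> w \<in> {}}"
        using a r by (auto simp: B_def)
    qed (use \<gamma> in \<open>auto simp: B_def intro!: holomorphic_intros holomorphic_on_subset[OF g]\<close>)
    also have "(\<Sum>p\<in>{w \<in> B. g w - a = 0 \<or> w \<in> {}}. winding_number \<gamma> p * 1 * zorder (\<lambda>w. g w - a) p)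
      = (\<Sum>p\<in>Z a. winding_number \<gamma> p * 1 * zorder (\<lambda>w. g w - a) p)"
    proof (rule sum.mono_neutral_right)
      show "finite {w \<in> B. g w - a = 0 \<or> w \<in> {}}"
        using finZ[of a] by simp
      show "Z a \<subseteq> {w \<in> B. g w - a = 0 \<or> w \<in> {}}"
        using r by (auto simp: Z_def B_def)
      show "\<forall>i\<in>{w \<in> B. g w - a = 0 \<or> w \<in> {}} - Z a. winding_number \<gamma> i * 1 * zorder (\<lambda>w. g w - a) i = 0"
      proof
        fix w assume w: "w \<in> {w \<in> B. g w - a = 0 \<or> w \<in> {}} - Z a"
        then have "w \<notin> ?C" "w \<notin> I"
          using a by (auto simp: Z_def)
        then have "w \<in> outside ?C"
          using J by auto
        then show "winding_number \<gamma> w * 1 * zorder (\<lambda>w. g w - a) w = 0"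
          using \<gamma> by (simp add: winding_number_zero_in_outside simple_path_imp_path)
      qed
    qed
    also have "\<dots> = \<epsilon> * of_int (\<Sum>p\<in>Z a. zorder (\<lambda>w. g w - a) p)"
      using \<epsilon>(2) by (simp add: Z_def sum_distrib_left)
    finally have *: "contour_integral \<gamma> (\<lambda>x. deriv (\<lambda>w. g w - a) x / (g x - a)) =
         2 * pi * \<i> * (\<epsilon> * of_int (\<Sum>p\<in>Z a. zorder (\<lambda>w. g w - a) p))"
      by simp
    have d: "deriv (\<lambda>w. g w - a) x = deriv g x" for x
    proof -
      have "(g has_field_derivative deriv g x) (at x)"
        using g by (auto intro: holomorphic_derivI)
      then show ?thesis
        by (intro DERIV_imp_deriv) (auto intro!: derivative_eq_intros)
    qed
    show ?thesis
      using winding_number_comp_holomorphic[OF g _ \<gamma>(1), of a] a * by (simp add: d)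
  qed
  have pos: "zorder (\<lambda>w. g w - a) p > 0" if "p \<in> Z a" for p a
  proof -
    have "(\<lambda>w. g w - a) holomorphic_on UNIV"
      using g by (intro holomorphic_intros)
    with that freq zorder_pos_iff[of "\<lambda>w. g w - a" UNIV p] show ?thesis
      by (simp add: Z_def)
  qed
  \<comment> \<open>Zeros have positive order and cannot cancel, whereas the image curve does not
    wind around outer points.\<close>
  have out: "Z a = {}" if a: "a \<in> outside (g ` ?C)" for a
  proof (rule ccontr)
    assume "Z a \<noteq> {}"
    then have "(\<Sum>p\<in>Z a. zorder (\<lambda>w. g w - a) p) > 0"
      using pos fin_Z by (intro sum_pos) auto
    moreover have "winding_number (g \<circ> \<gamma>) a = 0"
      using a pim sp cl by (intro winding_number_zero_in_outside) (auto simp: simple_path_imp_path)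
    moreover have "a \<notin> g ` ?C"
      using a outside_no_overlap by blast
    ultimately have "of_int (\<Sum>p\<in>Z a. zorder (\<lambda>w. g w - a) p) = (0 :: complex)"
      using count[of a] \<epsilon>(1) by (auto simp del: of_int_sum)
    then show False
      using \<open>(\<Sum>p\<in>Z a. zorder (\<lambda>w. g w - a) p) > 0\<close> by (simp del: of_int_sum)
  qed
  \<comment> \<open>The image curve lies in the closure of its outside, so an open image touching
    the curve would also meet the outside, contrary to \<open>out\<close>.\<close>
  have into: "g ` I \<subseteq> inside (g ` ?C)"
  proof clarify
    fix z assume z: "z \<in> I"
    have "open (g ` I)"
      using open_mapping_thm[OF g open_UNIV _ _ _ nonconst, of I] J by auto
    have "g z \<notin> closure (outside (g ` ?C))"
    proof
      assume "g z \<in> closure (outside (g ` ?C))"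
      then have "g ` I \<inter> outside (g ` ?C) \<noteq> {}"
        using z open_Int_closure_eq_empty[OF \<open>open (g ` I)\<close>, of "outside (g ` ?C)"] by blast
      then show False
        using out by (auto simp: Z_def)
    qed
    moreover have "closure (outside (g ` ?C)) = g ` ?C \<union> outside (g ` ?C)"
      unfolding closure_Un_frontier using Jg by (simp add: Un_commute)
    ultimately show "g z \<in> inside (g ` ?C)"
      using inside_Un_outside[of "g ` ?C"] by blast
  qed
  \<comment> \<open>The orders of the zeros are positive integers whose sum has absolute value
    1.\<close>
  have card1: "card (Z a) = 1" if a: "a \<in> inside (g ` ?C)" for a
  proof -
    define s where "s = (\<Sum>p\<in>Z a. zorder (\<lambda>w. g w - a) p)"
    have "norm (winding_number (g \<circ> \<gamma>) a) = 1"
      using simple_closed_path_norm_winding_number_inside[OF sp] a pim by auto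
    moreover have "a \<notin> g ` ?C"
      using a inside_no_overlap by blast
    ultimately have "norm (complex_of_int s) = 1"
      using count[of a] \<epsilon>(1) by (auto simp: s_def norm_mult)
    then have s1: "\<bar>s\<bar> = 1"
      by (metis norm_of_int of_int_1 of_int_abs of_int_eq_iff)
    have "int (card (Z a)) = (\<Sum>p\<in>Z a. 1)"
      by simp
    also have "\<dots> \<le> s"
      unfolding s_def using pos by (intro sum_mono) force
    finally have "card (Z a) \<le> 1"
      using s1 by linarith
    moreover have "Z a \<noteq> {}"
      using s1 by (auto simp: s_def)
    ultimately show ?thesis
      using fin_Z[of a] by (metis One_nat_def card_0_eq le_Suc_eq le_zero_eq)
  qed
  show "inj_on g (inside ?C)"
  proof (rule inj_onI)
    fix x y assume xy: "x \<in> inside ?C" "y \<in> inside ?C" "g x = g y"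
    then have "card (Z (g x)) = 1" "x \<in> Z (g x)" "y \<in> Z (g x)"
      using card1 into by (auto simp: Z_def I_def)
    then show "x = y"
      by (metis card_1_singletonE singletonD)
  qed
  show "g ` inside ?C = inside (g ` ?C)"
  proof
    show "inside (g ` ?C) \<subseteq> g ` inside ?C"
    proof
      fix a assume "a \<in> inside (g ` ?C)"
      then have "Z a \<noteq> {}"
        using card1[of a] by force
      then show "a \<in> g ` inside ?C"
        by (auto simp: Z_def I_def)
    qed
  qed (use into I_def in auto)
qed

section \<open>Nested Jordan curves\<close>

lemma connected_disjoint_inside_or_outside:
  assumes "connected T" "T \<inter> C = {}"
  shows "T \<subseteq> inside C \<or> T \<subseteq> outside C"
  using inside_outside_intersect_connected[OF assms(1), of C] assms(2) inside_Un_outside[of C] by blast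

text \<open>Each curve is connected and misses the other, so it lies on one side of it. Taking
  closures of the sides, whose frontiers are the curves, turns this into a statement about
  discs.\<close>

lemma Jordan_curves_disjoint:
  fixes p q :: "real \<Rightarrow> complex"
  assumes p: "simple_path p" "pathfinish p = pathstart p" "path_image p = C"
    and q: "simple_path q" "pathfinish q = pathstart q" "path_image q = D"
    and disj: "C \<inter> D = {}"
  obtains "C \<union> inside C \<subseteq> inside D" | "D \<union> inside D \<subseteq> inside C"
    | "(C \<union> inside C) \<inter> (D \<union> inside D) = {}"
proof -
  have nest: "C \<union> inside C \<subseteq> inside D"
    if p: "simple_path p" "pathfinish p = pathstart p" "path_image p = C"
    and q: "simple_path q" "pathfinish q = pathstart q" "path_image q = D"
    and disj: "C \<inter> D = {}" and CD: "C \<subseteq> inside D" for C D and p q :: "real \<Rightarrow> complex"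
  proof -
    note JC = Jordan_inside_outside[OF p(1,2), unfolded p(3)]
    note JD = Jordan_inside_outside[OF q(1,2), unfolded q(3)]
    have "outside D \<inter> C = {}"
      using CD JD by blast
    moreover have "\<not> outside D \<subseteq> inside C" "connected (outside D)"
      using JC JD bounded_subset[of "inside C" "outside D"] by auto
    ultimately have "outside D \<subseteq> outside C"
      using connected_disjoint_inside_or_outside[of "outside D" C] by blast
    then have "closure (outside D) \<subseteq> closure (outside C)"
      by (rule closure_mono)
    moreover have "closure (outside D) = outside D \<union> D"
      unfolding closure_Un_frontier using JD by simp
    moreover have "closure (outside C) = outside C \<union> C"
      unfolding closure_Un_frontier using JC by simp
    ultimately have "outside D \<union> D \<subseteq> outside C"
      using disj \<open>outside D \<subseteq> outside C\<close> by blast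
    then show ?thesis
      using inside_Un_outside[of C] inside_Un_outside[of D] inside_Int_outside[of C]
        outside_no_overlap[of C] by blast
  qed
  note JC = Jordan_inside_outside[OF p(1,2), unfolded p(3)]
  note JD = Jordan_inside_outside[OF q(1,2), unfolded q(3)]
  have "connected C" "connected D"
    using p q by (auto simp: connected_simple_path_image)
  then consider "C \<subseteq> inside D" | "D \<subseteq> inside C" | "C \<subseteq> outside D" "D \<subseteq> outside C"
    using connected_disjoint_inside_or_outside[of C D] connected_disjoint_inside_or_outside[of D C]
      disj by blast
  then show thesis
  proof cases
    case 1
    then show ?thesis
      using nest[OF p q disj] that(1) by blast
  next
    case 2
    then show ?thesis
      using nest[OF q p] disj that(2) by blast
  next
    case 3
    have "inside D \<inter> C = {}"
      using 3 JD by blast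
    have "D \<noteq> {}"
      using q(3) by force
    have "\<not> inside D \<subseteq> inside C"
    proof
      assume "inside D \<subseteq> inside C"
      then have "closure (inside D) \<subseteq> closure (inside C)"
        by (rule closure_mono)
      moreover have "closure (inside D) = inside D \<union> D"
        unfolding closure_Un_frontier using JD by simp
      moreover have "closure (inside C) = inside C \<union> C"
        unfolding closure_Un_frontier using JC by simp
      ultimately show False
        using 3 \<open>D \<noteq> {}\<close> inside_Int_outside[of C] disj by blast
    qed
    then have "inside D \<subseteq> outside C"
      using connected_disjoint_inside_or_outside[of "inside D" C] JD \<open>inside D \<inter> C = {}\<close> by blast
    then show ?thesis
      using 3 that(3) outside_no_overlap[of C] inside_Int_outside[of C] by blast
  qed
qed

section \<open>Fatou sets of meromorphic functions with an omitted value\<close>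

lemma continuous_on_stereo: "continuous_on UNIV stereo"
proof -
  have "(cmod z)\<^sup>2 + 1 \<noteq> 0" for z
    using zero_le_power2[of "cmod z"] by linarith
  then show ?thesis
    unfolding stereo_def[abs_def] by (intro continuous_intros) auto
qed

locale meromorphic_omitting =
  fixes f :: "complex \<Rightarrow> complex" and b :: complex
  assumes meromorphic: "meromorphic_plane f" and omitted: "omitted_value f b"
begin

abbreviation "P \<equiv> poles f"

text \<open>The value at a pole is prescribed because the total function \<open>f\<close> is
  arbitrary there; 0 makes the poles of \<open>f\<close> the zeros of an entire function.\<close>

definition g :: "complex \<Rightarrow> complex" where
  "g z = (if z \<in> P then 0 else 1 / (f z - b))"

lemma closed_poles: "closed P"
  using meromorphic by (simp add: meromorphic_plane_def closed_limpt)

lemma holomorphic_f: "f holomorphic_on - P"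
  using meromorphic by (simp add: meromorphic_plane_def Compl_eq_Diff_UNIV)

lemma f_neq_b: "z \<notin> P \<Longrightarrow> f z \<noteq> b"
  using omitted by (simp add: omitted_value_def)

lemma g_eq_0_iff: "g z = 0 \<longleftrightarrow> z \<in> P"
  using f_neq_b by (simp add: g_def)

lemma f_eq_g: "z \<notin> P \<Longrightarrow> f z = b + 1 / g z"
  using f_neq_b by (simp add: g_def)

text \<open>Poles are isolated and \<open>f - b\<close> tends to infinity there, so \<open>g\<close>
  tends to its prescribed value 0 and the singularity is removable.\<close>

lemma holomorphic_g: "g holomorphic_on UNIV"
proof -
  have hol: "g holomorphic_on - P"
  proof (rule holomorphic_transform)
    show "(\<lambda>z. 1 / (f z - b)) holomorphic_on - P"
      using holomorphic_f f_neq_b by (intro holomorphic_intros) auto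
  qed (auto simp: g_def)
  have "g field_differentiable (at z)" for z
  proof -
    have "\<not> z islimpt P"
      using meromorphic by (simp add: meromorphic_plane_def)
    then obtain e where e: "e > 0" "\<And>x. x \<in> P \<Longrightarrow> x \<noteq> z \<Longrightarrow> \<not> dist x z < e"
      unfolding islimpt_approachable by blast
    then have e': "P \<inter> ball z e \<subseteq> {z}"
      by (metis IntE dist_commute insertCI mem_ball subsetI)
    have "g holomorphic_on ball z e"
    proof (rule no_isolated_singularity'[of "P \<inter> ball z e"])
      fix p assume p: "p \<in> P \<inter> ball z e"
      then have "filterlim f at_infinity (at p)"
        by (simp add: poles_def is_pole_def)
      then have "filterlim (\<lambda>x. f x - b) at_infinity (at p)"
        using tendsto_add_filterlim_at_infinity'[OF _ tendsto_const[of "-b"]] by (simp add: add.commute)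
      then have "((\<lambda>x. inverse (f x - b)) \<longlongrightarrow> 0) (at p)"
        by (rule filterlim_compose[OF tendsto_inverse_0])
      moreover have "\<forall>\<^sub>F x in at p. inverse (f x - b) = g x"
        unfolding eventually_at using e e' p
        by (intro exI[of _ e]) (auto simp: g_def inverse_eq_divide)
      ultimately have "(g \<longlongrightarrow> 0) (at p)"
        using tendsto_cong by fast
      then show "(g \<longlongrightarrow> g p) (at p within ball z e)"
        using p tendsto_within_subset[OF \<open>(g \<longlongrightarrow> 0) (at p)\<close>, of "ball z e"] by (simp add: g_def)
    next
      show "g holomorphic_on ball z e - P \<inter> ball z e"
        by (rule holomorphic_on_subset[OF hol]) auto
      show "finite (P \<inter> ball z e)"
        using finite_subset[OF e'] by simp
    qed auto
    then show ?thesis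
      using e by (meson centre_in_ball holomorphic_on_imp_differentiable_at open_ball)
  qed
  then show ?thesis
    by (simp add: holomorphic_on_def field_differentiable_at_within)
qed

section \<open>Openness, a normality criterion and forward invariance of the Fatou set\<close>

lemma fatou_pole_free: "z \<in> fatou_set f \<Longrightarrow> (f ^^ k) z \<notin> P"
  by (auto simp: fatou_set_def)

lemma open_fatou: "open (fatou_set f)"
  unfolding open_subopen[of "fatou_set f"]
proof
  fix z assume "z \<in> fatou_set f"
  then obtain U where "open U" "z \<in> U" "\<forall>w\<in>U. \<forall>k. (f ^^ k) w \<notin> poles f"
      "normal_family_on U (\<lambda>n. f ^^ n)"
    unfolding fatou_set_def by blast
  then show "\<exists>T. open T \<and> z \<in> T \<and> T \<subseteq> fatou_set f"
    by (intro exI[of _ U]) (auto simp: fatou_set_def)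
qed

lemma holomorphic_iterate:
  assumes "\<And>k z. k < n \<Longrightarrow> z \<in> U \<Longrightarrow> (f ^^ k) z \<notin> P"
  shows "(f ^^ n) holomorphic_on U"
  using assms
proof (induction n)
  case 0
  then show ?case
    by (auto intro: holomorphic_intros simp: id_def)
next
  case (Suc n)
  have "(f \<circ> (f ^^ n)) holomorphic_on U"
    using Suc by (intro holomorphic_on_compose_gen[OF _ holomorphic_f]) auto
  then show ?case
    by (simp add: o_def)
qed

text \<open>Montel's theorem gives convergent subsequences in the plane. All values stay in one
  closed ball, on which \<open>stereo\<close> is uniformly continuous, so the convergence passes to
  the chordal metric.\<close>

lemma bounded_orbits_subset_fatou:
  assumes U: "open U" and K: "bounded K"
    and orb: "\<And>k z. z \<in> U \<Longrightarrow> (f ^^ k) z \<in> K - P"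
  shows "U \<subseteq> fatou_set f"
proof -
  obtain B where B: "\<And>w. w \<in> K \<Longrightarrow> cmod w \<le> B"
    using K by (auto simp: bounded_iff)
  have hol: "(f ^^ k) holomorphic_on U" for k
    using orb by (intro holomorphic_iterate) auto
  have "normal_family_on U (\<lambda>n. f ^^ n)"
    unfolding normal_family_on_def
  proof
    fix \<sigma> :: "nat \<Rightarrow> nat"
    obtain l r where lr: "strict_mono (r :: nat \<Rightarrow> nat)" "\<And>x. x \<in> U \<Longrightarrow> (\<lambda>n. (f ^^ \<sigma> (r n)) x) \<longlonglongrightarrow> l x"
      "\<And>X. compact X \<Longrightarrow> X \<subseteq> U \<Longrightarrow> uniform_limit X ((\<lambda>n. f ^^ \<sigma> n) \<circ> r) l sequentially"
    proof (rule Montel[of U "range (\<lambda>k. f ^^ k)" "\<lambda>n. f ^^ \<sigma> n"])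
      show "\<exists>B. \<forall>h\<in>range (\<lambda>k. f ^^ k). \<forall>z\<in>X. cmod (h z) \<le> B" if "X \<subseteq> U" for X
        using that orb B by (intro exI[of _ B]) blast
    qed (use U hol in auto)
    have "uniform_limit X (\<lambda>k. stereo \<circ> (f ^^ \<sigma> (r k))) (stereo \<circ> l) sequentially"
      if X: "compact X" "X \<subseteq> U" for X
    proof -
      have "uniform_limit X (\<lambda>k x. stereo ((f ^^ \<sigma> (r k)) x)) (stereo \<circ> l) sequentially"
      proof (rule uniform_limit_compose)
        show "uniform_limit X (\<lambda>k. f ^^ \<sigma> (r k)) l sequentially"
          using lr(3)[OF X] by (simp add: o_def)
        show "uniformly_continuous_on (cball 0 B) stereo"
          by (intro compact_uniformly_continuous continuous_on_subset[OF continuous_on_stereo]) auto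
        show "\<forall>\<^sub>F n in sequentially. (f ^^ \<sigma> (r n)) ` X \<subseteq> cball 0 B"
          using X orb B by (auto intro!: always_eventually)
        show "l ` X \<subseteq> cball 0 B"
        proof clarify
          fix x assume "x \<in> X"
          then have "x \<in> U"
            using X by auto
          moreover have "cmod ((f ^^ \<sigma> (r n)) x) \<le> B" for n
            using orb[OF \<open>x \<in> U\<close>] B by auto
          ultimately have "cmod (l x) \<le> B"
            using Lim_bounded[OF tendsto_norm[OF lr(2)]] by blast
          then show "l x \<in> cball 0 B"
            by simp
        qed
      qed
      then show ?thesis
        by (simp add: o_def)
    qed
    with lr(1) show "\<exists>r l. strict_mono r \<and> (\<forall>X. compact X \<and> X \<subseteq> U \<longrightarrow>
         uniform_limit X (\<lambda>k. stereo \<circ> (f ^^ \<sigma> (r k))) l sequentially)"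
      by blast
  qed
  then show ?thesis
    using U orb by (auto simp: fatou_set_def)
qed

text \<open>The image of a small ball around \<open>z\<close> is a neighbourhood of
  \<open>f z\<close>, and the iterates there are those near \<open>z\<close> shifted by one.\<close>

lemma fatou_forward:
  assumes nonconst: "\<not> g constant_on UNIV" and z: "z \<in> fatou_set f"
  shows "f z \<in> fatou_set f"
proof -
  obtain U where U: "open U" "z \<in> U" "\<forall>w\<in>U. \<forall>k. (f ^^ k) w \<notin> poles f"
      and normal: "normal_family_on U (\<lambda>n. f ^^ n)"
    using z unfolding fatou_set_def by blast
  obtain e where e: "e > 0" "cball z e \<subseteq> U"
    using U open_contains_cball by blast
  have pf: "w \<notin> P" if "w \<in> cball z e" for w
    using that U e by (metis funpow_0 subsetD)
  \<comment> \<open>Openness is taken from the entire function \<open>g\<close> and carried through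
    the inversion at \<open>b\<close>.\<close>
  have "open (g ` ball z e)"
    using open_mapping_thm[OF holomorphic_g open_UNIV _ _ _ nonconst] by auto
  moreover have "continuous_on (- {b}) (\<lambda>x. 1 / (x - b))"
    by (intro continuous_intros) auto
  ultimately have "open ((- {b}) \<inter> (\<lambda>x. 1 / (x - b)) -` (g ` ball z e))"
    by (intro continuous_open_preimage) auto
  moreover have "f ` ball z e = (- {b}) \<inter> (\<lambda>x. 1 / (x - b)) -` (g ` ball z e)"
  proof
    show "f ` ball z e \<subseteq> (- {b}) \<inter> (\<lambda>x. 1 / (x - b)) -` (g ` ball z e)"
    proof (intro image_subsetI IntI vimageI)
      fix w assume w: "w \<in> ball z e"
      then have "w \<notin> P"
        using pf by simp
      then show "1 / (f w - b) = g w" "f w \<in> - {b}"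
        using f_neq_b by (auto simp: g_def)
      show "g w \<in> g ` ball z e"
        using w by blast
    qed
    show "(- {b}) \<inter> (\<lambda>x. 1 / (x - b)) -` (g ` ball z e) \<subseteq> f ` ball z e"
    proof
      fix x assume x: "x \<in> (- {b}) \<inter> (\<lambda>x. 1 / (x - b)) -` (g ` ball z e)"
      then obtain w where w: "w \<in> ball z e" "1 / (x - b) = g w"
        by auto
      then have "f w = b + 1 / (1 / (x - b))"
        using f_eq_g[of w] pf[of w] by simp
      then have "x = f w"
        by simp
      then show "x \<in> f ` ball z e"
        using w(1) by (rule image_eqI)
    qed
  qed
  ultimately have N: "open (f ` ball z e)"
    by simp
  \<comment> \<open>A section of \<open>f\<close> chosen without continuity: uniform convergence on
    all of \<open>cball z e\<close> transfers along any map into that ball.\<close>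
  define h where "h = inv_into (ball z e) f"
  have h: "h y \<in> ball z e" "f (h y) = y" if "y \<in> f ` ball z e" for y
    using that unfolding h_def by (rule inv_into_into, rule f_inv_into_f)
  have shift: "(f ^^ k) (f w) = (f ^^ Suc k) w" for k w
    by (simp add: funpow_swap1)
  have "normal_family_on (f ` ball z e) (\<lambda>n. f ^^ n)"
    unfolding normal_family_on_def
  proof
    fix \<sigma> :: "nat \<Rightarrow> nat"
    obtain r l where rl: "strict_mono r" "\<And>K. compact K \<Longrightarrow> K \<subseteq> U \<Longrightarrow>
        uniform_limit K (\<lambda>k. stereo \<circ> (f ^^ Suc (\<sigma> (r k)))) l sequentially"
      using normal[unfolded normal_family_on_def, THEN spec, of "\<lambda>k. Suc (\<sigma> k)"] by blast
    have "uniform_limit K (\<lambda>k. stereo \<circ> (f ^^ \<sigma> (r k))) (\<lambda>y. l (h y)) sequentially"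
      if K: "K \<subseteq> f ` ball z e" for K
    proof -
      have "uniform_limit (cball z e) (\<lambda>k. stereo \<circ> (f ^^ Suc (\<sigma> (r k)))) l sequentially"
        using e rl(2) by simp
      then have "uniform_limit K (\<lambda>k y. (stereo \<circ> (f ^^ Suc (\<sigma> (r k)))) (h y)) (\<lambda>y. l (h y)) sequentially"
        by (rule uniform_limit_compose') (use h K in fastforce)
      then show ?thesis
        by (rule uniform_limit_cong'[THEN iffD1, rotated -1])
          (use h K in \<open>auto simp: shift[symmetric] simp del: funpow.simps\<close>)
    qed
    with rl(1) show "\<exists>r l. strict_mono r \<and> (\<forall>K. compact K \<and> K \<subseteq> f ` ball z e \<longrightarrow>
         uniform_limit K (\<lambda>k. stereo \<circ> (f ^^ \<sigma> (r k))) l sequentially)"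
      by blast
  qed
  moreover have "\<forall>w\<in>f ` ball z e. \<forall>k. (f ^^ k) w \<notin> P"
  proof clarify
    fix w k assume w: "w \<in> ball z e" "(f ^^ k) (f w) \<in> P"
    then have "(f ^^ Suc k) w \<in> P" "w \<in> U"
      using shift e by auto
    then show False
      using U by blast
  qed
  ultimately show ?thesis
    unfolding fatou_set_def using N e by (intro CollectI exI[of _ "f ` ball z e"]) auto
qed

end

section \<open>Cycles of rings and their invariant curves\<close>

lemma connected_open_relatively_closed_eq:
  assumes "connected S" "open X" "X \<subseteq> S" "X \<noteq> {}" "S \<inter> closure X \<subseteq> X"
  shows "X = S"
proof -
  have "X \<inter> S = {} \<or> - closure X \<inter> S = {}"
    using assms closure_subset[of X] by (intro connectedD) auto
  then show ?thesis
    using assms by blast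
qed

text \<open>Abstracts a cycle of Herman rings \<open>R i\<close> with one invariant curve in each.
  Indices run over all naturals with period \<open>q\<close>, so \<open>f\<close> always raises the
  index by one. \<open>sides\<close> is the trace of the rotation: a concentric curve joins a point
  to its image under a return. \<open>not_I_subset_R\<close> records that the curve surrounds a hole
  of the ring.\<close>

locale ring_cycle = meromorphic_omitting +
  fixes \<gamma> :: "nat \<Rightarrow> real \<Rightarrow> complex" and R :: "nat \<Rightarrow> complex set" and q :: nat
    and C I Ou :: "nat \<Rightarrow> complex set"
  defines "C \<equiv> (\<lambda>i. path_image (\<gamma> i))" and "I \<equiv> (\<lambda>i. inside (C i))" and "Ou \<equiv> (\<lambda>i. outside (C i))"
  assumes q_pos: "q > 0"
    and \<gamma>: "valid_path (\<gamma> i)" "simple_path (\<gamma> i)" "pathfinish (\<gamma> i) = pathstart (\<gamma> i)"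
    and C_subset_R: "C i \<subseteq> R i"
    and open_R: "open (R i)" and connected_R: "connected (R i)"
    and R_fatou: "R i \<subseteq> fatou_set f"
    and closure_R: "closure (R i) \<inter> fatou_set f \<subseteq> R i"
    and R_disjoint: "i mod q \<noteq> j mod q \<Longrightarrow> R i \<inter> R j = {}"
    and C_add: "C (i + q) = C i"
    and f_C: "f ` C i = C (Suc i)" and inj_C: "inj_on f (C i)"
    and not_I_subset_R: "\<not> I i \<subseteq> R i"
    and sides: "z \<in> R i \<Longrightarrow> z \<notin> C i \<Longrightarrow>
      \<exists>L. connected L \<and> L \<inter> C i = {} \<and> z \<in> L \<and> (f ^^ (q * k)) z \<in> L"
begin

lemma shows open_I: "open (I i)" and connected_I: "connected (I i)" and I_nonempty: "I i \<noteq> {}"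
    and bounded_I: "bounded (I i)" and frontier_I: "frontier (I i) = C i"
    and open_Ou: "open (Ou i)" and connected_Ou: "connected (Ou i)"
    and unbounded_Ou: "\<not> bounded (Ou i)" and frontier_Ou: "frontier (Ou i) = C i"
  using Jordan_inside_outside[OF \<gamma>(2,3)] by (simp_all add: C_def I_def Ou_def)

lemma side_disjoint: "I i \<inter> C i = {}" "Ou i \<inter> C i = {}" "I i \<inter> Ou i = {}"
  unfolding I_def Ou_def by simp_all

lemma side_cases: "z \<in> C i \<or> z \<in> I i \<or> z \<in> Ou i"
  using inside_Un_outside[of "C i"] unfolding I_def Ou_def by blast

lemma closure_I: "closure (I i) = I i \<union> C i"
  by (simp add: closure_Un_frontier frontier_I)

lemma closure_Ou: "closure (Ou i) = Ou i \<union> C i"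
  by (simp add: closure_Un_frontier frontier_Ou)

lemma compact_disc: "compact (I i \<union> C i)"
  using bounded_I[of i] by (metis closure_I compact_closure)

lemma C_nonempty: "C i \<noteq> {}" and compact_C: "compact (C i)"
  using \<gamma>(2) by (auto simp: C_def compact_simple_path_image)

lemma C_mult: "C (i + k * q) = C i"
proof (induction k)
  case (Suc k)
  have "i + Suc k * q = (i + k * q) + q"
    by simp
  then show ?case
    using Suc C_add by metis
qed simp

lemma C_mod: "i mod q = j mod q \<Longrightarrow> C i = C j"
  by (metis C_mult mod_div_mult_eq)

lemma C_disjoint: "i mod q \<noteq> j mod q \<Longrightarrow> C i \<inter> C j = {}"
  using R_disjoint[of i j] C_subset_R[of i] C_subset_R[of j] by blast

lemma C_disjoint_or_eq: "C i = C j \<or> C i \<inter> C j = {}"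
  using C_mod C_disjoint by blast

lemma R_no_pole: "z \<in> R i \<Longrightarrow> (f ^^ k) z \<notin> P"
  using R_fatou fatou_pole_free by blast

lemma C_no_pole: "z \<in> C i \<Longrightarrow> z \<notin> P"
  using R_no_pole[of z i 0] C_subset_R by auto

text \<open>Every curve is the image of its predecessor, indexed \<open>i + q - 1\<close> to stay
  within the naturals, and \<open>b\<close> is omitted.\<close>

lemma b_notin_C: "b \<notin> C i"
proof
  assume "b \<in> C i"
  moreover have "C i = f ` C (i + q - 1)"
    using q_pos C_add[of i] f_C[of "i + q - 1"] by simp
  ultimately show False
    using f_neq_b C_no_pole by force
qed

section \<open>Images of the discs bounded by the curves\<close>

lemma inj_g_C: "inj_on g (C i)"
proof (rule inj_onI)
  fix x y assume xy: "x \<in> C i" "y \<in> C i" "g x = g y"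
  then have "f x = f y"
    using f_eq_g[of x] f_eq_g[of y] C_no_pole by auto
  then show "x = y"
    using inj_C xy by (auto simp: inj_on_def)
qed

lemma inj_g_I: "inj_on g (I i)" and g_I: "g ` I i = inside (g ` C i)"
  using entire_inj_inside[OF holomorphic_g \<gamma>] inj_g_C[of i] by (auto simp: C_def I_def)

lemma inj_f_I: "inj_on f (I i - P)"
proof (rule inj_onI)
  fix x y assume xy: "x \<in> I i - P" "y \<in> I i - P" "f x = f y"
  then have "g x = g y"
    by (simp add: g_def)
  then show "x = y"
    using inj_g_I xy by (auto simp: inj_on_def)
qed

lemma f_I_C_disjoint: "z \<in> I i - P \<Longrightarrow> f z \<notin> C (Suc i)"
proof
  assume z: "z \<in> I i - P" and "f z \<in> C (Suc i)"
  then obtain y where y: "y \<in> C i" "f z = f y"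
    using f_C by blast
  then have "g z = g y"
    using z C_no_pole by (auto simp: g_def)
  moreover have "g z \<in> inside (g ` C i)"
    using z g_I by blast
  ultimately show False
    using y inside_no_overlap[of "g ` C i"] by (metis disjoint_iff imageI)
qed

lemma open_f_I: "open (f ` (I i - P))"
  using open_I closed_poles inj_f_I
  by (intro open_mapping_thm3 holomorphic_on_subset[OF holomorphic_f] open_Diff) auto

text \<open>The image of the disc is open and connected, misses \<open>C (Suc i)\<close>, and gains
  only points of that curve under closure; so it is a full side. Compactness of the closed disc
  rules out the unbounded one.\<close>

lemma f_I_no_pole:
  assumes "I i \<inter> P = {}"
  shows "f ` I i = I (Suc i)" and "b \<notin> I (Suc i)"
proof -
  have IP: "I i - P = I i"
    using assms by blast
  have "continuous_on (I i \<union> C i) f"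
    using assms C_no_pole
    by (intro holomorphic_on_imp_continuous_on holomorphic_on_subset[OF holomorphic_f]) blast
  then have "compact (f ` (I i \<union> C i))"
    using compact_disc by (intro compact_continuous_image)
  moreover have "f ` (I i \<union> C i) = f ` I i \<union> C (Suc i)"
    using f_C by (simp add: image_Un)
  ultimately have K: "compact (f ` I i \<union> C (Suc i))"
    by simp
  then have cl: "closure (f ` I i) \<subseteq> f ` I i \<union> C (Suc i)"
    by (intro closure_minimal compact_imp_closed) auto
  have bdd: "bounded (f ` I i)"
    using K compact_imp_bounded bounded_subset by blast
  have op: "open (f ` I i)"
    using open_f_I[of i] IP by simp
  have ne: "f ` I i \<noteq> {}"
    using I_nonempty by simp
  have rel: "S \<inter> closure (f ` I i) \<subseteq> f ` I i" if "S \<inter> C (Suc i) = {}" for S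
    using that cl by blast
  have disj: "f ` I i \<inter> C (Suc i) = {}"
    using f_I_C_disjoint[of _ i] IP by auto
  have "connected (f ` I i)"
    using assms connected_I
    by (intro connected_continuous_image holomorphic_on_imp_continuous_on
        holomorphic_on_subset[OF holomorphic_f]) blast+
  then consider "f ` I i \<subseteq> I (Suc i)" | "f ` I i \<subseteq> Ou (Suc i)"
    using connected_disjoint_inside_or_outside[OF _ disj] unfolding I_def Ou_def by blast
  then show "f ` I i = I (Suc i)"
  proof cases
    case 1
    then show ?thesis
      by (intro connected_open_relatively_closed_eq connected_I op ne rel side_disjoint)
  next
    case 2
    then have "f ` I i = Ou (Suc i)"
      by (intro connected_open_relatively_closed_eq connected_Ou op ne rel side_disjoint)
    then show ?thesis
      using bdd unbounded_Ou by simp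
  qed
  then show "b \<notin> I (Suc i)"
    using assms f_neq_b by (metis disjoint_iff imageE)
qed

text \<open>In the coordinate \<open>g\<close> the pole becomes 0, so the image is the inversion of
  the bounded open set \<open>W\<close> punctured at 0: unbounded, yet bounded away from
  \<open>b\<close>.\<close>

lemma f_I_pole:
  assumes "I i \<inter> P \<noteq> {}"
  shows "f ` (I i - P) = Ou (Suc i)" and "b \<in> I (Suc i)"
proof -
  define W where "W = g ` I i"
  define X where "X = f ` (I i - P)"
  let ?T = "\<lambda>x. 1 / (x - b)"
  have W0: "0 \<in> W"
    using assms g_eq_0_iff by (force simp: W_def)
  have W: "open W" "connected W"
    unfolding W_def using open_I connected_I inj_g_I holomorphic_g
    by (auto intro!: open_mapping_thm3 connected_continuous_image holomorphic_on_imp_continuous_on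
        intro: holomorphic_on_subset)
  have cW: "compact (W \<union> g ` C i)"
    unfolding W_def image_Un[symmetric] using holomorphic_g
    by (intro compact_continuous_image compact_disc holomorphic_on_imp_continuous_on)
      (auto intro: holomorphic_on_subset)
  have X: "X = (\<lambda>w. b + 1 / w) ` (W - {0})"
  proof -
    have "W - {0} = g ` (I i - P)"
      using g_eq_0_iff by (auto simp: W_def)
    then show ?thesis
      unfolding X_def image_image using f_eq_g by (auto simp: image_def)
  qed
  have T: "?T ` X \<subseteq> W"
    unfolding X by auto
  have disj: "X \<inter> C (Suc i) = {}"
    using f_I_C_disjoint by (auto simp: X_def)
  have "connected X"
    unfolding X using W
    by (intro connected_continuous_image connected_open_delete continuous_intros) auto
  obtain M where M: "M > 0" "\<And>w. w \<in> W \<Longrightarrow> cmod w \<le> M"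
    using compact_imp_bounded[OF cW] by (auto simp: bounded_pos)
  have "\<not> bounded X"
  proof
    assume "bounded X"
    then obtain B where B: "B > 0" "\<And>x. x \<in> X \<Longrightarrow> cmod x \<le> B"
      by (auto simp: bounded_pos)
    obtain e where e: "e > 0" "ball 0 e \<subseteq> W"
      using W W0 open_contains_ball by blast
    \<comment> \<open>A point of \<open>W\<close> so close to 0 that \<open>b + 1 / t\<close> has
      modulus above \<open>B\<close>; the extra 1 gives strictness.\<close>
    define t where "t = min (e / 2) (1 / (B + cmod b + 1))"
    have pos: "B + cmod b + 1 > 0"
      using B norm_ge_zero[of b] by linarith
    have t: "t > 0" "t < e"
      using e pos by (auto simp: t_def min_def)
    have "t \<le> 1 / (B + cmod b + 1)"
      by (simp add: t_def)
    then have t1: "1 / t \<ge> B + cmod b + 1"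
      using t pos by (simp add: field_simps)
    have "complex_of_real t \<in> W - {0}"
      using t e by auto
    then have "cmod (b + 1 / of_real t) \<le> B"
      using B(2) unfolding X by blast
    moreover have "cmod (1 / of_real t) \<le> cmod (b + 1 / of_real t) + cmod b"
      using norm_triangle_ineq4[of "b + 1 / of_real t" b] by simp
    moreover have "cmod (1 / of_real t) = 1 / t"
      using t by (simp add: norm_divide)
    ultimately show False
      using t1 by linarith
  qed
  then have "\<not> X \<subseteq> I (Suc i)"
    using bounded_I bounded_subset by blast
  then have X_Ou: "X \<subseteq> Ou (Suc i)"
    using connected_disjoint_inside_or_outside[OF \<open>connected X\<close> disj] by (auto simp: I_def Ou_def)
  \<comment> \<open>Boundedness of \<open>W\<close> keeps \<open>X\<close> away from
    \<open>b\<close>, so the inversion is continuous on the closure of \<open>X\<close>.\<close>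
  have "X \<subseteq> {x. 1 / M \<le> cmod (x - b)}"
  proof
    fix x assume x: "x \<in> X"
    then have "cmod (?T x) \<le> M"
      using T M by blast
    moreover have "x \<noteq> b"
      using x f_neq_b by (auto simp: X_def)
    ultimately show "x \<in> {x. 1 / M \<le> cmod (x - b)}"
      using M(1) by (simp add: norm_divide field_simps)
  qed
  moreover have "closed {x. 1 / M \<le> cmod (x - b)}"
    by (intro closed_Collect_le continuous_intros)
  ultimately have "closure X \<subseteq> {x. 1 / M \<le> cmod (x - b)}"
    by (rule closure_minimal)
  then have b_cl: "b \<notin> closure X"
    using M(1) by auto
  have "X \<noteq> {}"
    using \<open>\<not> bounded X\<close> by auto
  have "continuous_on (closure X) ?T"
    using b_cl by (intro continuous_intros) auto
  then have Tcl: "?T ` closure X \<subseteq> W \<union> g ` C i"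
    using T compact_imp_closed[OF cW] by (intro image_closure_subset) auto
  \<comment> \<open>The inversion of a limit point lies in \<open>W\<close> or on the
    \<open>g\<close>-image of \<open>C i\<close>. The latter would put the point on
    \<open>C (Suc i)\<close>; a nonzero point of \<open>W\<close> inverts back into
    \<open>X\<close>.\<close>
  have "Ou (Suc i) \<inter> closure X \<subseteq> X"
  proof
    fix x assume x: "x \<in> Ou (Suc i) \<inter> closure X"
    then have "x \<noteq> b"
      using b_cl by auto
    have "?T x \<notin> g ` C i"
    proof
      assume "?T x \<in> g ` C i"
      then obtain y where y: "y \<in> C i" "?T x = g y"
        by auto
      then have "x = f y"
        using f_eq_g[of y] C_no_pole[of y] by (simp flip: y(2))
      then show False
        using y f_C x side_disjoint by blast
    qed
    then have "?T x \<in> W - {0}"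
      using Tcl x \<open>x \<noteq> b\<close> by auto
    then have "b + 1 / ?T x \<in> X"
      unfolding X by blast
    then show "x \<in> X"
      by simp
  qed
  then have "X = Ou (Suc i)"
    using X_Ou \<open>X \<noteq> {}\<close> open_f_I[of i, folded X_def]
    by (intro connected_open_relatively_closed_eq connected_Ou)
  then show "f ` (I i - P) = Ou (Suc i)"
    by (simp add: X_def)
  have "b \<notin> Ou (Suc i)"
    unfolding \<open>X = Ou (Suc i)\<close>[symmetric] using b_cl closure_subset by blast
  then show "b \<in> I (Suc i)"
    using side_cases b_notin_C by blast
qed

end

context ring_cycle
begin

section \<open>Maximality of the rings, enclosed poles and nested discs\<close>

lemma I_meets_R: "I i \<inter> R i \<noteq> {}"
proof -
  obtain x where "x \<in> C i"
    using C_nonempty by blast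
  then have "x \<in> closure (I i) \<inter> R i"
    using closure_I C_subset_R by blast
  then show ?thesis
    using open_Int_closure_eq_empty[OF open_R[of i], of "I i"] by blast
qed

lemma Ou_meets_R: "Ou i \<inter> R i \<noteq> {}"
proof -
  obtain x where "x \<in> C i"
    using C_nonempty by blast
  then have "x \<in> closure (Ou i) \<inter> R i"
    using closure_Ou C_subset_R by blast
  then show ?thesis
    using open_Int_closure_eq_empty[OF open_R[of i], of "Ou i"] by blast
qed

text \<open>It suffices to control the points of \<open>U\<close> adherent to the ring:
  \<open>closure_R\<close> then makes the ring relatively open and closed in
  \<open>U\<close>.\<close>

lemma R_maximal:
  assumes U: "connected U" "U \<inter> R i \<noteq> {}" and "U \<inter> closure (R i) \<subseteq> fatou_set f"
  shows "U \<subseteq> R i"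
proof -
  have "U \<inter> closure (R i) \<subseteq> R i"
    using assms closure_R by blast
  then have "R i \<inter> U = {} \<or> - closure (R i) \<inter> U = {}"
    using open_R closure_subset[of "R i"] U(1) by (intro connectedD) auto
  then show ?thesis
    using U(2) \<open>U \<inter> closure (R i) \<subseteq> R i\<close> by blast
qed

lemma f_pow_C: "(f ^^ k) ` C i = C (i + k)"
proof (induction k)
  case (Suc k)
  have "(f ^^ Suc k) ` C i = f ` ((f ^^ k) ` C i)"
    by (simp add: image_comp)
  then show ?case
    using Suc f_C by simp
qed simp

lemma I_cong: "C i = C j \<Longrightarrow> I i = I j" and Ou_cong: "C i = C j \<Longrightarrow> Ou i = Ou j"
  by (simp_all add: I_def Ou_def)

lemma bounded_UN_I: "bounded (\<Union>i. I i)"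
proof -
  have "(\<Union>i. I i) = (\<Union>i<q. I i)"
  proof
    show "(\<Union>i. I i) \<subseteq> (\<Union>i<q. I i)"
    proof clarify
      fix x i assume "x \<in> I i"
      moreover have "I i = I (i mod q)"
        by (intro I_cong C_mod) simp
      ultimately show "x \<in> (\<Union>i<q. I i)"
        using q_pos by (intro UN_I[of "i mod q"]) auto
    qed
  qed auto
  then show ?thesis
    using bounded_I by (simp add: bounded_UN)
qed

text \<open>Without poles the discs would map onto one another with bounded orbits, which puts
  \<open>I i\<close> into the Fatou set and hence into the ring, against
  \<open>not_I_subset_R\<close>.\<close>

lemma pole_inside: "\<exists>k. I (i + k) \<inter> P \<noteq> {}"
proof (rule ccontr)
  assume "\<nexists>k. I (i + k) \<inter> P \<noteq> {}"
  then have np: "I (i + k) \<inter> P = {}" for k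
    by blast
  have im: "(f ^^ k) ` I i = I (i + k)" for k
  proof (induction k)
    case (Suc k)
    have "(f ^^ Suc k) ` I i = f ` ((f ^^ k) ` I i)"
      by (simp add: image_comp)
    then show ?case
      using Suc f_I_no_pole(1)[OF np[of k]] by simp
  qed simp
  have "I i \<subseteq> fatou_set f"
  proof (rule bounded_orbits_subset_fatou[OF open_I bounded_UN_I])
    fix k z assume "z \<in> I i"
    then have "(f ^^ k) z \<in> I (i + k)"
      using im[of k] by blast
    then show "(f ^^ k) z \<in> (\<Union>i. I i) - P"
      using np[of k] by blast
  qed
  then have "I i \<subseteq> R i"
    using I_meets_R connected_I by (intro R_maximal) auto
  then show False
    using not_I_subset_R by blast
qed

lemma disc_cases:
  "C i = C j \<or> C i \<union> I i \<subseteq> I j \<or> C j \<union> I j \<subseteq> I i \<or> (C i \<union> I i) \<inter> (C j \<union> I j) = {}"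
proof (cases "C i = C j")
  case False
  then have disj: "C i \<inter> C j = {}"
    using C_disjoint_or_eq by blast
  have im: "path_image (\<gamma> k) = C k" for k
    by (simp add: C_def)
  show ?thesis
    unfolding I_def
    by (rule Jordan_curves_disjoint[OF \<gamma>(2,3) im \<gamma>(2,3) im disj]) blast+
qed blast

lemma C_inside_imp_disc_inside:
  assumes "C i \<subseteq> I j"
  shows "C i \<union> I i \<subseteq> I j"
proof -
  have "C i \<noteq> C j"
    using assms side_disjoint(1)[of j] C_nonempty[of i] by blast
  moreover have "\<not> C j \<union> I j \<subseteq> I i"
    using assms side_disjoint(1)[of i] C_nonempty[of i] by blast
  moreover have "(C i \<union> I i) \<inter> (C j \<union> I j) \<noteq> {}"
    using assms C_nonempty[of i] by blast
  ultimately show ?thesis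
    using disc_cases[of i j] by blast
qed

text \<open>A pole inside one curve puts \<open>b\<close> inside the next. The discs around
  \<open>b\<close> are finite in number and pairwise comparable, so a maximal one contains the
  others.\<close>

lemma outermost_exists:
  obtains s where "b \<in> I s" "\<And>t. b \<in> I t \<Longrightarrow> I t \<subseteq> I s"
proof -
  obtain k where "I (0 + k) \<inter> P \<noteq> {}"
    using pole_inside by blast
  then have "b \<in> I (Suc k)"
    using f_I_pole(2) by simp
  define A where "A = I ` {i. i < q \<and> b \<in> I i}"
  have in_A: "I i \<in> A" if "b \<in> I i" for i
  proof -
    have "I i = I (i mod q)"
      by (intro I_cong C_mod) simp
    then show ?thesis
      using that q_pos by (auto simp: A_def)
  qed
  have "finite A" "A \<noteq> {}"
    using in_A[OF \<open>b \<in> I (Suc k)\<close>] by (auto simp: A_def)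
  then obtain X where X: "X \<in> A" "\<And>Y. Y \<in> A \<Longrightarrow> X \<subseteq> Y \<Longrightarrow> X = Y"
    by (meson finite_has_maximal)
  then obtain s where s: "X = I s" "b \<in> I s"
    by (auto simp: A_def)
  have "I t \<subseteq> I s" if t: "b \<in> I t" for t
    using disc_cases[of s t] I_cong[of s t] X(2)[OF in_A[OF t]] s t by blast
  then show thesis
    using that s by blast
qed

end

section \<open>The outermost curve around the omitted value\<close>

text \<open>\<open>N\<close> is the first delay at which the discs following the outermost one reach
  a pole, so \<open>F\<close>, one step longer, is the first iterate with a pole in
  \<open>D\<close>.\<close>

locale ring_cycle_outermost = ring_cycle +
  fixes s N :: nat
  assumes b_in: "b \<in> I s" and outermost: "b \<in> I t \<Longrightarrow> I t \<subseteq> I s"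
    and no_pole: "r < N \<Longrightarrow> I (s + r) \<inter> P = {}" and pole: "I (s + N) \<inter> P \<noteq> {}"
begin

abbreviation "D \<equiv> I s"
abbreviation "F \<equiv> f ^^ Suc N"
text \<open>On the points \<open>D'\<close> that are not poles of \<open>F\<close>, the value of \<open>f ^^ k\<close> is meaningful for all \<open>k \<le> Suc N\<close>;
\<open>a i\<close> is the index of the image of the curve \<open>C s\<close> under \<open>F ^^ Suc i\<close>.\<close>

definition "D' = {z \<in> D. (f ^^ N) z \<notin> P}"
definition "a i = s + Suc i * Suc N"
definition "E i = C (a i) \<union> I (a i)"

lemma a_Suc: "a (Suc i) = Suc (a i + N)"
  by (simp add: a_def)

lemma a_0: "a 0 = Suc (s + N)"
  by (simp add: a_def)

lemma f_pow_D: "r \<le> N \<Longrightarrow> (f ^^ r) ` D = I (s + r) \<and> inj_on (f ^^ r) D"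
proof (induction r)
  case (Suc r)
  then have IH: "(f ^^ r) ` D = I (s + r)" "inj_on (f ^^ r) D" and np: "I (s + r) \<inter> P = {}"
    using no_pole by auto
  have "I (s + r) - P = I (s + r)"
    using np by blast
  then have "inj_on f ((f ^^ r) ` D)"
    using inj_f_I[of "s + r"] IH by simp
  moreover have "(f ^^ Suc r) ` D = f ` ((f ^^ r) ` D)"
    by (simp add: image_comp)
  ultimately show ?case
    using f_I_no_pole(1)[OF np] IH comp_inj_on[OF IH(2), of f] by (simp add: o_def)
qed simp

lemma f_pow_I:
  assumes "I j \<subseteq> D"
  shows "r \<le> N \<Longrightarrow> (f ^^ r) ` I j = I (j + r)"
proof (induction r)
  case (Suc r)
  then have IH: "(f ^^ r) ` I j = I (j + r)"
    by simp
  moreover have "(f ^^ r) ` I j \<subseteq> I (s + r)"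
    using f_pow_D[of r] Suc.prems assms by auto
  ultimately have np: "I (j + r) \<inter> P = {}"
    using no_pole[of r] Suc.prems by auto
  have "(f ^^ Suc r) ` I j = f ` ((f ^^ r) ` I j)"
    by (simp add: image_comp)
  then show ?case
    using f_I_no_pole(1)[OF np] IH by simp
qed simp

lemma F_D': "F ` D' = Ou (a 0)"
proof -
  have "F ` D' = f ` ((f ^^ N) ` D')"
    by (simp add: image_comp)
  also have "(f ^^ N) ` D' = I (s + N) - P"
    using f_pow_D[of N] by (auto simp: D'_def)
  also have "f ` \<dots> = Ou (a 0)"
    using f_I_pole(1)[OF pole] by (simp add: a_0)
  finally show ?thesis .
qed

lemma inj_F: "inj_on F D'"
proof -
  have "(f ^^ N) ` D' \<subseteq> I (s + N) - P" "inj_on (f ^^ N) D'"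
    using f_pow_D[of N] by (auto simp: D'_def inj_on_def)
  then show ?thesis
    using comp_inj_on[of "f ^^ N" D' f] inj_on_subset[OF inj_f_I] by (simp add: o_def)
qed

lemma C_subset_D': "C j \<subseteq> D \<Longrightarrow> C j \<subseteq> D'"
  using R_no_pole C_subset_R[of j] by (auto simp: D'_def)

lemma F_disc:
  assumes "C j \<union> I j \<subseteq> D" and np: "I (j + N) \<inter> P = {}"
  shows "C j \<union> I j \<subseteq> D'" and "F ` (C j \<union> I j) = C (Suc (j + N)) \<union> I (Suc (j + N))"
proof -
  have N: "(f ^^ N) ` I j = I (j + N)"
    using f_pow_I assms by auto
  then have "(f ^^ N) z \<notin> P" if "z \<in> I j" for z
    using np that by blast
  then show "C j \<union> I j \<subseteq> D'"
    using assms C_subset_D'[of j] by (auto simp: D'_def)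
  have "F ` I j = f ` ((f ^^ N) ` I j)"
    by (simp add: image_comp)
  then show "F ` (C j \<union> I j) = C (Suc (j + N)) \<union> I (Suc (j + N))"
    using f_pow_C[of "Suc N" j] f_I_no_pole(1)[OF np] N by (simp only: image_Un add_Suc_right)
qed

text \<open>Otherwise \<open>Suc N\<close> is a multiple of \<open>q\<close> and \<open>F\<close> a
  power of the return map, which by \<open>sides\<close> keeps ring points on their side of
  \<open>C s\<close>; but \<open>F\<close> carries all of \<open>D'\<close> outside.\<close>

lemma C_a0_neq: "C (a 0) \<noteq> C s"
proof
  assume eq: "C (a 0) = C s"
  have "a 0 mod q = s mod q"
    using C_disjoint[of "a 0" s] eq C_nonempty by auto
  then have "q dvd Suc N"
    unfolding a_def by (simp add: mod_eq_dvd_iff_nat)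
  then obtain k where k: "Suc N = q * k" ..
  obtain z where z: "z \<in> D" "z \<in> R s"
    using I_meets_R by blast
  then have "z \<in> D'"
    using R_no_pole by (auto simp: D'_def)
  then have "F z \<in> Ou s"
    using F_D' Ou_cong[OF eq] by blast
  moreover have "z \<notin> C s"
    using z side_disjoint by blast
  then obtain L where "connected L" "L \<inter> C s = {}" "z \<in> L" "F z \<in> L"
    using sides[OF z(2), of k] k by auto
  ultimately show False
    using connected_disjoint_inside_or_outside[of L "C s"] z side_disjoint(3)[of s]
    unfolding I_def Ou_def by blast
qed

text \<open>This curve follows a disc with a pole, so it surrounds \<open>b\<close> and is nested in
  the outermost one, strictly by \<open>C_a0_neq\<close>.\<close>

lemma E_0_subset: "E 0 \<subseteq> D"
proof -
  have "b \<in> I (a 0)"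
    using f_I_pole(2)[OF pole] by (simp add: a_0)
  then show ?thesis
    using disc_cases[of "a 0" s] C_a0_neq outermost[of "a 0"] side_disjoint(1)[of s] C_nonempty[of s] b_in
    unfolding E_def by blast
qed

text \<open>The curves recur: \<open>F\<close> maps \<open>C (a (q - 1))\<close> to
  \<open>C (a 0)\<close>. If all of them stayed in \<open>D\<close>, this image would lie in
  \<open>Ou (a 0)\<close>.\<close>

lemma E_escapes: "\<exists>M. \<not> C (a M) \<subseteq> D"
proof (rule ccontr)
  assume "\<nexists>M. \<not> C (a M) \<subseteq> D"
  then have "F ` C (a (q - 1)) \<subseteq> Ou (a 0)"
    using C_subset_D'[of "a (q - 1)"] F_D' by blast
  moreover have "F ` C (a (q - 1)) = C (a 0)"
  proof -
    obtain q' where "q = Suc q'"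
      using q_pos by (cases q) auto
    then have "a (q - 1) + Suc N = a 0 + Suc N * q"
      by (simp add: a_def algebra_simps)
    then show ?thesis
      using f_pow_C[of "Suc N" "a (q - 1)"] C_mult[of "a 0" "Suc N"] by simp
  qed
  ultimately show False
    using C_nonempty[of "a 0"] side_disjoint(2)[of "a 0"] by blast
qed

definition "M = (LEAST M. \<not> C (a M) \<subseteq> D)"

lemma not_C_M: "\<not> C (a M) \<subseteq> D"
  unfolding M_def using E_escapes by (rule LeastI_ex)

lemma E_subset_D: "i < M \<Longrightarrow> E i \<subseteq> D"
  using not_less_Least[of i "\<lambda>M. \<not> C (a M) \<subseteq> D"] C_inside_imp_disc_inside[of "a i" s]
  by (auto simp: M_def E_def)

lemma M_pos: "M > 0"
  using not_C_M E_0_subset by (cases M) (auto simp: E_def)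

lemma compact_E: "compact (E i)"
  using compact_disc by (simp add: E_def Un_commute)

lemma F_E:
  assumes "i < M" "I (a i + N) \<inter> P = {}"
  shows "E i \<subseteq> D'" "F ` E i = E (Suc i)"
  using F_disc[of "a i"] E_subset_D[of i] assms by (simp_all add: E_def a_Suc)

text \<open>The curves differ, hence so do the rings. The connected \<open>R s\<close> contains
  \<open>C s\<close>, so it stays outside the disc; openness of \<open>I (a i)\<close> and
  \<open>R (a i)\<close> extends this to the closure.\<close>

lemma R_s_disjoint:
  assumes "i < M"
  shows "closure (R s) \<inter> E i = {}"
proof -
  have sub: "C (a i) \<subseteq> D" "I (a i) \<subseteq> D"
    using E_subset_D[OF assms] by (auto simp: E_def)
  then have "C (a i) \<noteq> C s"
    using side_disjoint(1)[of s] C_nonempty[of s] by blast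
  then have RR: "R s \<inter> R (a i) = {}"
    using C_mod R_disjoint by metis
  then have "R s \<inter> C (a i) = {}"
    using C_subset_R by blast
  then have "R s \<subseteq> I (a i) \<or> R s \<subseteq> Ou (a i)"
    using connected_disjoint_inside_or_outside[OF connected_R] unfolding I_def Ou_def by blast
  moreover have "\<not> R s \<subseteq> I (a i)"
    using C_subset_R[of s] sub(2) side_disjoint(1)[of s] C_nonempty[of s] by blast
  ultimately have "R s \<inter> I (a i) = {}"
    using side_disjoint(3)[of "a i"] by blast
  then have "closure (R s) \<inter> I (a i) = {}" "closure (R s) \<inter> R (a i) = {}"
    using open_I open_R RR open_Int_closure_eq_empty by (metis inf_commute)+
  then show ?thesis
    using C_subset_R[of "a i"] by (auto simp: E_def)
qed

text \<open>Let \<open>E m\<close> be the first disc containing the pole of \<open>F\<close>.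
  Removing \<open>E 0\<close>, ..., \<open>E m\<close> from \<open>D\<close> leaves an
  \<open>F\<close>-invariant set of Fatou points, which forces all of \<open>D\<close> into
  \<open>R s\<close> although \<open>E 0\<close> is disjoint from that ring.\<close>

lemma no_pole_before_escape:
  assumes "i < M"
  shows "I (a i + N) \<inter> P = {}"
proof (rule ccontr)
  assume "I (a i + N) \<inter> P \<noteq> {}"
  define m where "m = (LEAST i. I (a i + N) \<inter> P \<noteq> {})"
  have m: "I (a m + N) \<inter> P \<noteq> {}"
    unfolding m_def using \<open>I (a i + N) \<inter> P \<noteq> {}\<close> by (rule LeastI)
  have "m \<le> i"
    unfolding m_def using \<open>I (a i + N) \<inter> P \<noteq> {}\<close> by (rule Least_le)
  then have mM: "m < M"
    using assms by simp
  have np: "I (a j + N) \<inter> P = {}" if "j < m" for j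
    using not_less_Least[of j "\<lambda>i. I (a i + N) \<inter> P \<noteq> {}"] that unfolding m_def by blast
  define X where "X = D - (\<Union>j\<le>m. E j)"
  let ?t = "a (Suc m)"
  have t: "f ` (I (a m + N) - P) = Ou ?t" "b \<in> I ?t"
    using f_I_pole[OF m] by (simp_all add: a_Suc)
  have Em: "E m \<subseteq> D"
    using E_subset_D[OF mM] .
  have N_I: "(f ^^ N) ` I (a m) = I (a m + N)"
    using f_pow_I[of "a m" N] Em by (auto simp: E_def)
  have step: "(f ^^ N) z \<notin> P" "F z \<in> X" if z: "z \<in> X" for z
  proof -
    have zD: "z \<in> D" and zE: "\<And>j. j \<le> m \<Longrightarrow> z \<notin> E j"
      using z by (auto simp: X_def)
    \<comment> \<open>\<open>F\<close> has only one pole in \<open>D\<close>, since \<open>g\<close>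
      vanishes at poles and \<open>g\<close> after \<open>f ^^ N\<close> is injective on
      \<open>D\<close>. That pole lies in the removed \<open>E m\<close>.\<close>
    show y: "(f ^^ N) z \<notin> P"
    proof
      assume zP: "(f ^^ N) z \<in> P"
      obtain p where p: "p \<in> (f ^^ N) ` I (a m)" "p \<in> P"
        using m unfolding N_I by blast
      then obtain w where "w \<in> I (a m)" "p = (f ^^ N) w"
        by (elim imageE)
      with p have w: "w \<in> I (a m)" "(f ^^ N) w \<in> P"
        by simp_all
      have "g ((f ^^ N) z) = g ((f ^^ N) w)"
        using zP w by (simp add: g_def)
      moreover have "w \<in> D"
        using w Em by (auto simp: E_def)
      ultimately have "z = w"
        using inj_g_I[of "s + N"] f_pow_D[of N] zD by (metis image_eqI inj_onD order_refl)
      then show False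
        using w zE[of m] by (simp add: E_def)
    qed
    then have zD': "z \<in> D'"
      using zD by (simp add: D'_def)
    have inj: "F z \<noteq> F w" if "w \<in> D'" "w \<in> E j" "j \<le> m" for w j
      using inj_onD[OF inj_F, of z w] zD' that zE by blast
    \<comment> \<open>\<open>F\<close> attains every value in \<open>C ?t\<close> and
      \<open>Ou ?t\<close> already on \<open>E m\<close>, so injectivity leaves only the
      inside.\<close>
    have "F z \<in> I ?t"
    proof -
      have "F z \<notin> C ?t"
      proof
        assume "F z \<in> C ?t"
        then obtain w where "w \<in> C (a m)" "F z = F w"
          using f_pow_C[of "Suc N" "a m"] by (auto simp: a_Suc simp del: funpow.simps)
        then show False
          using inj[of w m] C_subset_D'[of "a m"] Em by (auto simp: E_def)
      qed
      moreover have "F z \<notin> Ou ?t"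
      proof
        assume "F z \<in> Ou ?t"
        then obtain w where "w \<in> I (a m)" "(f ^^ N) w \<notin> P" "F z = F w"
          unfolding t(1)[symmetric] N_I[symmetric] by auto
        then show False
          using inj[of w m] Em by (auto simp: E_def D'_def)
      qed
      ultimately show ?thesis
        using side_cases by blast
    qed
    then have "F z \<in> D"
      using outermost[OF t(2)] by blast
    \<comment> \<open>On \<open>D'\<close> no value of \<open>F\<close> lies in \<open>E 0\<close>,
      and each later \<open>E j\<close> is the image of its predecessor, which \<open>z\<close>
      avoids.\<close>
    moreover have "F z \<notin> E j" if "j \<le> m" for j
    proof (cases j)
      case 0
      have "F z \<in> Ou (a 0)"
        using zD' F_D' by blast
      then show ?thesis
        using 0 side_disjoint[of "a 0"] by (auto simp: E_def)
    next
      case (Suc i)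
      then have "E j = F ` E i" "E i \<subseteq> D'"
        using F_E[of i] np[of i] that mM by auto
      then show ?thesis
        using inj[of _ i] that Suc by fastforce
    qed
    ultimately show "F z \<in> X"
      by (auto simp: X_def)
  qed
  have orbit: "(F ^^ j) z \<in> X" if "z \<in> X" for j z
    using that by (induction j) (auto simp: step(2) simp del: funpow.simps(2) simp: funpow.simps(2)[of _ F])
  have "X \<subseteq> fatou_set f"
  proof (rule bounded_orbits_subset_fatou[OF _ bounded_UN_I])
    show "open X"
      unfolding X_def using compact_E by (intro open_Diff open_I closed_UN) (auto intro: compact_imp_closed)
    fix k z assume z: "z \<in> X"
    \<comment> \<open>The \<open>k\<close> steps of \<open>f\<close> split into full applications of
      \<open>F\<close>, which stay in \<open>X\<close>, and a rest of \<open>r \<le> N\<close>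
      steps, which leads into \<open>I (s + r)\<close>.\<close>
    define w where "w = (F ^^ (k div Suc N)) z"
    define r where "r = k mod Suc N"
    have r: "r \<le> N"
      unfolding r_def using mod_less_divisor[of "Suc N" k] by linarith
    have w: "w \<in> X"
      unfolding w_def using orbit z .
    have "k = r + Suc N * (k div Suc N)"
      unfolding r_def by (metis mod_mult_div_eq)
    then have k: "(f ^^ k) z = (f ^^ r) w"
      unfolding w_def funpow_mult by (metis comp_apply funpow_add mult.commute)
    have "(f ^^ r) w \<in> I (s + r)"
      using f_pow_D[OF r] w by (auto simp: X_def)
    moreover have "(f ^^ r) w \<notin> P"
      using \<open>(f ^^ r) w \<in> I (s + r)\<close> no_pole[of r] r step(1)[OF w] by (cases "r = N") auto
    ultimately show "(f ^^ k) z \<in> (\<Union>i. I i) - P"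
      unfolding k by blast
  qed
  moreover have "closure (R s) \<inter> E j = {}" if "j \<le> m" for j
    using R_s_disjoint that mM by simp
  then have "D \<inter> closure (R s) \<subseteq> X"
    unfolding X_def by blast
  ultimately have "D \<subseteq> R s"
    using I_meets_R connected_I by (intro R_maximal) auto
  then show False
    using R_s_disjoint[OF M_pos] E_0_subset closure_subset[of "R s"] C_nonempty[of "a 0"]
    unfolding E_def by blast
qed

text \<open>The preceding disc is mapped without a pole, so \<open>b\<close> is not in
  \<open>I (a M)\<close>. Hence this disc neither equals nor contains \<open>D\<close>, and it does
  not lie in \<open>D\<close> by the choice of \<open>M\<close>.\<close>

lemma E_M_subset: "E M \<subseteq> Ou s"
proof -
  obtain k where k: "M = Suc k" "k < M"
    using M_pos by (cases M) auto
  have "b \<notin> I (a M)"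
    using f_I_no_pole(2)[OF no_pole_before_escape[OF k(2)]] by (simp add: k(1) a_Suc)
  then have "(C (a M) \<union> I (a M)) \<inter> (C s \<union> I s) = {}"
    using disc_cases[of "a M" s] I_cong[of "a M" s] b_in not_C_M by blast
  then show ?thesis
    using side_cases[of _ s] unfolding E_def by blast
qed

end

text \<open>Treats the case left by \<open>no_pole_before_escape\<close>. A limit of iterates of the
  inverse branch on \<open>R s\<close> can be neither constant, by winding numbers, nor nonconstant,
  by disjointness of images.\<close>

lemma (in ring_cycle_outermost) no_outermost_curve: False
proof -

  \<comment> \<open>The inverse branch of \<open>F\<close> and its iterates\<close>
  let ?T = "\<lambda>x. 1 / (x - b)"
  \<comment> \<open>This is \<open>1 / (F - b)\<close> with the pole of \<open>F\<close> filled in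
    by 0. Its inverse is holomorphic on the simply connected \<open>W\<close>, where 0 stands for
    infinity.\<close>
  define \<Phi> where "\<Phi> = g \<circ> (f ^^ N)"
  define W where "W = \<Phi> ` D"
  have W_eq: "W = inside (path_image (g \<circ> \<gamma> (s + N)))"
  proof -
    have "W = g ` ((f ^^ N) ` D)"
      by (simp add: W_def \<Phi>_def image_comp)
    then show ?thesis
      using f_pow_D[of N] g_I[of "s + N"] by (simp add: path_image_compose C_def)
  qed
  have "simple_path (g \<circ> \<gamma> (s + N))"
    using \<gamma> inj_g_C[of "s + N"] holomorphic_on_subset[OF holomorphic_g]
    by (intro simple_path_comp_injective) (auto simp: C_def intro: holomorphic_on_imp_continuous_on)
  then have W: "simply_connected W"
    unfolding W_eq by (rule simply_connected_inside_simple_path)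
  have "(f ^^ N) holomorphic_on D"
  proof (rule holomorphic_iterate)
    fix k z assume "k < N" "z \<in> D"
    then show "(f ^^ k) z \<notin> P"
      using f_pow_D[of k] no_pole[of k] by fastforce
  qed
  then have "\<Phi> holomorphic_on D"
    unfolding \<Phi>_def using holomorphic_g by (rule holomorphic_on_compose_gen) auto
  moreover have "inj_on \<Phi> D"
    unfolding \<Phi>_def using f_pow_D[of N] inj_g_I[of "s + N"] by (intro comp_inj_on) auto
  ultimately obtain \<Gamma> where \<Gamma>: "\<Gamma> holomorphic_on W" "\<And>z. z \<in> D \<Longrightarrow> \<Gamma> (\<Phi> z) = z" and oW: "open W"
    unfolding W_def using open_I[of s] by (metis holomorphic_has_inverse open_mapping_thm3)
  have \<Gamma>D: "\<Gamma> w \<in> D" if "w \<in> W" for w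
    using that \<Gamma>(2) by (auto simp: W_def)
  have inj_\<Gamma>: "inj_on \<Gamma> W"
    using \<Gamma>(2) by (auto simp: W_def inj_on_def)
  define G where "G = (\<lambda>x. \<Gamma> (?T x))"
  have \<Phi>_T: "\<Phi> z = ?T (F z)" if "z \<in> D'" for z
    using that by (simp add: \<Phi>_def D'_def g_def)
  have G_F: "G (F z) = z" if "z \<in> D'" for z
    unfolding G_def \<Phi>_T[OF that, symmetric] using that \<Gamma>(2) by (simp add: D'_def)
  have Ou_F: "\<exists>z\<in>D'. x = F z" if "x \<in> Ou (a 0)" for x
    using that unfolding F_D'[symmetric] by blast
  have T_W: "?T x \<in> W" and G_D': "G x \<in> D'" and F_G: "F (G x) = x" if x: "x \<in> Ou (a 0)" for x
  proof -
    obtain z where z: "z \<in> D'" "x = F z"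
      using Ou_F x by blast
    then show "?T x \<in> W"
      unfolding z(2) \<Phi>_T[OF z(1), symmetric] using z(1) by (simp add: W_def D'_def)
    show "G x \<in> D'" "F (G x) = x"
      unfolding z(2) G_F[OF z(1)] using z by simp_all
  qed
  have b_E0: "b \<in> E 0"
    using f_I_pole(2)[OF pole] by (simp add: E_def a_0)
  have E0_Ou: "- E 0 = Ou (a 0)"
    using side_cases[of _ "a 0"] side_disjoint[of "a 0"] by (auto simp: E_def)
  have hol_T: "?T holomorphic_on (- {b})"
    by (auto intro!: holomorphic_intros)
  have hol_G: "G holomorphic_on Ou (a 0)"
  proof -
    have "\<Gamma> \<circ> ?T holomorphic_on Ou (a 0)"
      using b_E0 E0_Ou T_W by (intro holomorphic_on_compose_gen[OF _ \<Gamma>(1)] holomorphic_intros) auto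
    then show ?thesis
      by (simp add: G_def o_def)
  qed
  have F_E': "E i \<subseteq> D'" "F ` E i = E (Suc i)" if "i < M" for i
    using F_E[OF that no_pole_before_escape[OF that]] .
  define Y where "Y = - (\<Union>i\<le>M. E i)"
  have oY: "open Y"
    unfolding Y_def using compact_E by (intro open_Compl closed_UN) (auto intro: compact_imp_closed)
  have Y_Ou: "Y \<subseteq> Ou (a 0)"
    unfolding Y_def E0_Ou[symmetric] by blast
  \<comment> \<open>For \<open>i < M\<close>, a value of \<open>G\<close> in \<open>E i\<close>
    would come from a point of \<open>E (Suc i)\<close>; \<open>E M\<close> lies outside
    \<open>D\<close>, where \<open>G\<close> has no values on \<open>Y\<close>.\<close>
  have G_Y: "G x \<in> Y" "G x \<in> D" if x: "x \<in> Y" for x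
  proof -
    have GD: "G x \<in> D'" "F (G x) = x"
      using x Y_Ou G_D' F_G by blast+
    then show D: "G x \<in> D"
      by (simp add: D'_def)
    have "G x \<notin> E i" if "i \<le> M" for i
    proof (cases "i = M")
      case True
      then show ?thesis
        using D E_M_subset side_disjoint by blast
    next
      case False
      then have "i < M"
        using that by simp
      moreover have "x \<notin> E (Suc i)"
        using x \<open>i < M\<close> by (auto simp: Y_def)
      ultimately show ?thesis
        using F_E'(2)[of i] GD(2) by (metis image_eqI)
    qed
    then show "G x \<in> Y"
      by (auto simp: Y_def)
  qed
  have inj_G: "inj_on G Y"
    using F_G Y_Ou by (metis inj_onI subsetD)
  have Gk_Y: "(G ^^ k) x \<in> Y" if "x \<in> Y" for k x
    using that G_Y by (induction k) auto
  have Gk_D: "(G ^^ Suc k) x \<in> D" if "x \<in> Y" for k x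
    using G_Y(2)[OF Gk_Y[OF that]] by simp
  have inj_Gk: "inj_on (G ^^ k) Y" for k
  proof (induction k)
    case (Suc k)
    have "inj_on (G \<circ> (G ^^ k)) Y"
      using Suc inj_G Gk_Y by (intro comp_inj_on) (auto intro: inj_on_subset)
    then show ?case
      by (simp add: o_def)
  qed simp
  have hol_Gk: "(G ^^ k) holomorphic_on Y" for k
  proof (induction k)
    case (Suc k)
    have "(G \<circ> (G ^^ k)) holomorphic_on Y"
      using Suc Gk_Y by (intro holomorphic_on_compose_gen[OF _ holomorphic_on_subset[OF hol_G Y_Ou]]) auto
    then show ?case
      by (simp add: o_def)
  qed (auto intro: holomorphic_intros simp: id_def)
  have R_Y: "R s \<subseteq> Y"
  proof -
    have "R s \<inter> E i = {}" if "i < M" for i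
      using R_s_disjoint[OF that] closure_subset by blast
    \<comment> \<open>\<open>R_s_disjoint\<close> stops before \<open>M\<close>. Here
      \<open>I (a M)\<close> lies in \<open>Ou s\<close>, so it cannot contain \<open>C s\<close>,
      nor therefore \<open>R s\<close>.\<close>
    moreover have "R s \<inter> E M = {}"
    proof -
      have "C (a M) \<noteq> C s"
        using E_M_subset side_disjoint(2)[of s] C_nonempty[of s] unfolding E_def by blast
      then have RR: "R s \<inter> R (a M) = {}"
        using C_mod R_disjoint by metis
      then have "R s \<inter> C (a M) = {}"
        using C_subset_R by blast
      moreover from this have "R s \<subseteq> I (a M) \<or> R s \<subseteq> Ou (a M)"
        using connected_disjoint_inside_or_outside[OF connected_R] unfolding I_def Ou_def by blast
      moreover have "\<not> R s \<subseteq> I (a M)"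
        using C_subset_R[of s] E_M_subset side_disjoint(2)[of s] C_nonempty[of s] unfolding E_def by blast
      ultimately show ?thesis
        using side_disjoint(3)[of "a M"] by (auto simp: E_def)
    qed
    ultimately have "R s \<inter> E i = {}" if "i \<le> M" for i
      using that by (cases "i = M") auto
    then show ?thesis
      unfolding Y_def by blast
  qed

  \<comment> \<open>Winding numbers of the iterated image curves\<close>
  define good where "good = (\<lambda>\<sigma>. valid_path \<sigma> \<and> pathfinish \<sigma> = pathstart \<sigma> \<and> path_image \<sigma> \<subseteq> Y)"
  have conn_E: "connected (E i)" for i
  proof -
    have "E i = closure (I (a i))"
      by (simp add: E_def closure_I Un_commute)
    then show ?thesis
      using connected_I by (simp add: connected_imp_connected_closure)
  qed
  have wn_E: "winding_number \<sigma> x = winding_number \<sigma> y" if "good \<sigma>" "i \<le> M" "x \<in> E i" "y \<in> E i" for \<sigma> x y i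
    using that conn_E[of i]
    by (intro winding_number_eq[of \<sigma> x "E i" y]) (auto simp: good_def Y_def valid_path_imp_path)
  have good_G: "good (G \<circ> \<sigma>)" if "good \<sigma>" for \<sigma>
    using that G_Y(1) oY holomorphic_on_subset[OF hol_G Y_Ou]
    by (auto simp: good_def path_image_compose pathfinish_def pathstart_def intro: valid_path_compose_holomorphic)
  have G_T: "G \<circ> \<sigma> = \<Gamma> \<circ> (?T \<circ> \<sigma>)" for \<sigma> :: "real \<Rightarrow> complex"
    by (simp add: G_def o_def)
  have T_path: "valid_path (?T \<circ> \<sigma>)" "pathfinish (?T \<circ> \<sigma>) = pathstart (?T \<circ> \<sigma>)" "path_image (?T \<circ> \<sigma>) \<subseteq> W"
    "b \<notin> path_image \<sigma>"
    if "good \<sigma>" for \<sigma>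
  proof -
    show b: "b \<notin> path_image \<sigma>"
      using that b_E0 by (auto simp: good_def Y_def)
    show "valid_path (?T \<circ> \<sigma>)"
      using that b by (intro valid_path_compose_holomorphic[OF _ hol_T]) (auto simp: good_def)
    show "pathfinish (?T \<circ> \<sigma>) = pathstart (?T \<circ> \<sigma>)"
      using that by (simp add: good_def pathfinish_def pathstart_def)
    show "path_image (?T \<circ> \<sigma>) \<subseteq> W"
      using that Y_Ou T_W by (auto simp: good_def path_image_compose)
  qed
  \<comment> \<open>The inverse branch over the simply connected \<open>W\<close> takes its values
    in \<open>D\<close> and so omits \<open>x\<close>.\<close>
  have wn_M: "winding_number (G \<circ> \<sigma>) x = 0" if \<sigma>: "good \<sigma>" and x: "x \<in> E M" for \<sigma> x
  proof -
    have "x \<notin> \<Gamma> ` W"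
      using \<Gamma>D x E_M_subset side_disjoint(3)[of s] by blast
    then show ?thesis
      unfolding G_T using T_path[OF \<sigma>] by (intro winding_number_comp_eq_zero[OF \<Gamma>(1) oW W])
  qed
  \<comment> \<open>\<open>G\<close> is holomorphic at infinity, so \<open>G z - x\<close> is \<open>(z - F x) / (z - b)\<close> times the exponential of a
    holomorphic function.\<close>
  have wn_step: "winding_number (G \<circ> \<sigma>) x = winding_number \<sigma> (F x) - winding_number \<sigma> b"
    if \<sigma>: "good \<sigma>" and x: "x \<in> E i" and i: "i < M" for \<sigma> x i
  proof -
    have xD': "x \<in> D'" and Fx: "F x \<in> E (Suc i)"
      using x F_E'[OF i] by blast+
    then have Fx': "F x \<notin> path_image \<sigma>"
      using \<sigma> i by (fastforce simp: good_def Y_def)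
    have Fb: "F x \<noteq> b"
      using xD' f_neq_b by (simp add: D'_def)
    have \<Phi>x: "\<Phi> x \<in> W" "\<Gamma> (\<Phi> x) = x"
      using xD' \<Gamma>(2) by (auto simp: W_def D'_def)
    have "\<Phi> x \<notin> path_image (?T \<circ> \<sigma>)"
      using Fx' unfolding \<Phi>_T[OF xD'] path_image_compose by auto
    then have "winding_number (\<Gamma> \<circ> (?T \<circ> \<sigma>)) (\<Gamma> (\<Phi> x)) = winding_number (?T \<circ> \<sigma>) (\<Phi> x)"
      using T_path[OF \<sigma>] \<Phi>x by (intro winding_number_comp_injective[OF \<Gamma>(1) oW W inj_\<Gamma>]) auto
    also have "\<dots> = winding_number \<sigma> (F x) - winding_number \<sigma> b"
      unfolding \<Phi>_T[OF xD'] using \<sigma> T_path(4)[OF \<sigma>] Fx' Fb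
      by (intro winding_number_inverse) (auto simp: good_def)
    finally show ?thesis
      unfolding G_T \<Phi>x(2) .
  qed
  \<comment> \<open>One sample point in each disc, along the orbit of \<open>b\<close>, so that
    \<open>wn_step\<close> at \<open>e i\<close> compares the winding numbers around
    \<open>e (Suc i)\<close> and \<open>e 0\<close>.\<close>
  define e where "e i = (F ^^ i) b" for i
  have e: "e i \<in> E i" if "i \<le> M" for i
    using that
  proof (induction i)
    case (Suc i)
    then have "F (e i) \<in> E (Suc i)"
      using F_E'(2)[of i] by auto
    then show ?case
      by (simp add: e_def del: funpow.simps(2)) (simp only: funpow.simps(2)[of _ F] o_apply)
  qed (simp add: e_def b_E0)
  have F_e: "F (e i) = e (Suc i)" for i
    unfolding e_def by (simp only: funpow.simps(2)[of _ F] o_apply)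
  \<comment> \<open>By \<open>wn_step\<close>, if all new winding numbers vanished, all old ones
    would agree with the one around \<open>e 0\<close>.\<close>
  have nontrivial_step: "\<exists>i\<le>M. winding_number (G \<circ> \<sigma>) (e i) \<noteq> 0"
    if \<sigma>: "good \<sigma>" and ne: "\<exists>i\<le>M. winding_number \<sigma> (e i) \<noteq> winding_number \<sigma> (e 0)" for \<sigma>
  proof (rule ccontr)
    assume "\<nexists>i. i \<le> M \<and> winding_number (G \<circ> \<sigma>) (e i) \<noteq> 0"
    then have z: "winding_number (G \<circ> \<sigma>) (e i) = 0" if "i \<le> M" for i
      using that by blast
    have "winding_number \<sigma> (e (Suc i)) = winding_number \<sigma> (e 0)" if "i < M" for i
      using wn_step[OF \<sigma> e that] z[of i] that by (simp add: F_e) (simp add: e_def)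
    then have "winding_number \<sigma> (e i) = winding_number \<sigma> (e 0)" if "i \<le> M" for i
      using that by (cases i) auto
    then show False
      using ne by blast
  qed
  have e0: "e 0 = b"
    by (simp add: e_def)
  define \<sigma> where "\<sigma> k = (G ^^ k) \<circ> \<gamma> s" for k
  have \<sigma>_Suc: "\<sigma> (Suc k) = G \<circ> \<sigma> k" for k
    by (simp add: \<sigma>_def o_assoc)
  have "path_image (\<gamma> s) \<subseteq> Y"
    using R_Y C_subset_R[of s] by (auto simp: C_def)
  then have good_\<sigma>: "good (\<sigma> k)" for k
  proof (induction k)
    case 0
    then show ?case
      using \<gamma> by (simp add: \<sigma>_def good_def)
  qed (simp add: \<sigma>_Suc good_G)
  \<comment> \<open>Non-equality is the inductive invariant: the winding number around
    \<open>e M\<close> is always zero, and around some other \<open>e i\<close> it is not.\<close>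
  have ne_\<sigma>: "\<exists>i\<le>M. winding_number (\<sigma> k) (e i) \<noteq> winding_number (\<sigma> k) (e 0)" for k
  proof (induction k)
    case 0
    have "winding_number (\<gamma> s) (e M) = 0"
      using e[of M] E_M_subset \<gamma>
      by (intro winding_number_zero_in_outside) (auto simp: Ou_def C_def valid_path_imp_path)
    moreover have "norm (winding_number (\<gamma> s) (e 0)) = 1"
      using b_in \<gamma>(2) by (intro simple_closed_path_norm_winding_number_inside) (auto simp: e0 I_def C_def)
    ultimately show ?case
      unfolding \<sigma>_def by (intro exI[of _ M]) auto
  next
    case (Suc k)
    have "winding_number (\<sigma> (Suc k)) (e M) = 0"
      unfolding \<sigma>_Suc using wn_M[OF good_\<sigma> e] by simp
    moreover obtain i where "i \<le> M" "winding_number (\<sigma> (Suc k)) (e i) \<noteq> 0"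
      using nontrivial_step[OF good_\<sigma> Suc] unfolding \<sigma>_Suc by blast
    ultimately show ?case
      by (metis order_refl)
  qed
  have wind: "\<exists>i\<le>M. \<forall>x\<in>E i. winding_number (\<sigma> (Suc k)) x \<noteq> 0" for k
    using nontrivial_step[OF good_\<sigma> ne_\<sigma>, of k] wn_E[OF good_\<sigma>[of "Suc k"] _ e] unfolding \<sigma>_Suc
    by (metis)

  \<comment> \<open>Limit functions of the iterates on the ring\<close>
  have hol_R: "(G ^^ k) holomorphic_on R s" for k
    using hol_Gk R_Y holomorphic_on_subset by blast
  obtain B where B: "\<And>z. z \<in> D \<Longrightarrow> cmod z \<le> B"
    using bounded_I[of s] by (auto simp: bounded_iff)
  \<comment> \<open>Exponents start at 1 because \<open>G\<close> maps \<open>Y\<close> into the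
    bounded \<open>D\<close>, whereas the ring itself need not be bounded.\<close>
  obtain h r where hr: "h holomorphic_on R s" "strict_mono (r :: nat \<Rightarrow> nat)"
    "\<And>K. compact K \<Longrightarrow> K \<subseteq> R s \<Longrightarrow> uniform_limit K ((\<lambda>k. G ^^ Suc k) \<circ> r) h sequentially"
  proof (rule Montel[of "R s" "range (\<lambda>k. G ^^ Suc k)" "\<lambda>k. G ^^ Suc k"])
    show "\<exists>B. \<forall>h\<in>range (\<lambda>k. G ^^ Suc k). \<forall>z\<in>K. cmod (h z) \<le> B" if "K \<subseteq> R s" for K
      using that R_Y Gk_D B by (intro exI[of _ B]) blast
  qed (use open_R hol_R in \<open>auto simp del: funpow.simps\<close>)
  show False
  proof (cases "h constant_on R s")
    case True
    then obtain c where c: "\<And>z. z \<in> R s \<Longrightarrow> h z = c"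
      by (auto simp: constant_on_def)
    have "\<exists>x y. x \<in> E i \<and> y \<in> E i \<and> x \<noteq> y" for i
    proof (rule ccontr)
      assume "\<nexists>x y. x \<in> E i \<and> y \<in> E i \<and> x \<noteq> y"
      then have "\<exists>x. I (a i) = {x}"
        using I_nonempty[of "a i"] unfolding E_def by blast
      then show False
        using open_I[of "a i"] not_open_singleton by metis
    qed
    then obtain X Z where XZ: "\<And>i. X i \<in> E i" "\<And>i. Z i \<in> E i" "\<And>i. X i \<noteq> Z i"
      by metis
    \<comment> \<open>Half the smallest distance between the two chosen points of each
      \<open>E i\<close>, so that no \<open>E i\<close> with \<open>i \<le> M\<close> fits into a
      ball of radius \<epsilon>. A short curve winding around a whole \<open>E i\<close> would force
      this.\<close>
    define \<epsilon> where "\<epsilon> = Min ((\<lambda>i. dist (X i) (Z i)) ` {..M}) / 2"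
    have "\<epsilon> > 0"
      using XZ(3) unfolding \<epsilon>_def by (simp add: Min_gr_iff)
    have le: "2 * \<epsilon> \<le> dist (X i) (Z i)" if "i \<le> M" for i
      using that unfolding \<epsilon>_def by (simp add: Min_le)
    have "uniform_limit (C s) ((\<lambda>k. G ^^ Suc k) \<circ> r) h sequentially"
      using hr(3) compact_C C_subset_R by blast
    then have "\<exists>k. \<forall>n\<ge>k. \<forall>z\<in>C s. dist ((G ^^ Suc (r n)) z) (h z) < \<epsilon>"
      using \<open>\<epsilon> > 0\<close> unfolding uniform_limit_iff eventually_sequentially by (simp del: funpow.simps)
    then obtain k where k: "\<And>z. z \<in> C s \<Longrightarrow> dist ((G ^^ Suc (r k)) z) (h z) < \<epsilon>"
      by blast
    have sub: "path_image (\<sigma> (Suc (r k))) \<subseteq> ball c \<epsilon>"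
    proof
      fix w assume "w \<in> path_image (\<sigma> (Suc (r k)))"
      then obtain z where z: "z \<in> C s" "w = (G ^^ Suc (r k)) z"
        unfolding \<sigma>_def path_image_compose C_def by blast
      then show "w \<in> ball c \<epsilon>"
        using k[OF z(1)] c[of z] C_subset_R[of s] by (auto simp: dist_commute simp del: funpow.simps)
    qed
    obtain i where i: "i \<le> M" "\<And>x. x \<in> E i \<Longrightarrow> winding_number (\<sigma> (Suc (r k))) x \<noteq> 0"
      using wind by blast
    have "E i \<subseteq> ball c \<epsilon>"
    proof (rule ccontr)
      assume "\<not> E i \<subseteq> ball c \<epsilon>"
      then obtain x where "x \<in> E i" "x \<notin> ball c \<epsilon>"
        by blast
      then have "winding_number (\<sigma> (Suc (r k))) x = 0"
        using good_\<sigma>[of "Suc (r k)"] sub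
        by (intro winding_number_zero_outside[of _ "ball c \<epsilon>"]) (auto simp: good_def valid_path_imp_path)
      then show False
        using i \<open>x \<in> E i\<close> by blast
    qed
    then have "dist (X i) c < \<epsilon>" "dist (Z i) c < \<epsilon>"
      using XZ[of i] by (auto simp: dist_commute)
    then have "dist (X i) (Z i) < 2 * \<epsilon>"
      using dist_triangle2[of "X i" "Z i" c] by linarith
    then show False
      using le[OF i(1)] by linarith
  next
    case False
    \<comment> \<open>The ball is taken in the outer part of the ring, which positive iterates of
      \<open>G\<close> never reach.\<close>
    obtain z0 where z0: "z0 \<in> Ou s" "z0 \<in> R s"
      using Ou_meets_R by blast
    then obtain \<delta> where \<delta>: "\<delta> > 0" "ball z0 \<delta> \<subseteq> Ou s \<inter> R s"
      using open_contains_ball[of "Ou s \<inter> R s"] open_Ou open_R by blast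
    have nonconst: "\<not> h constant_on ball z0 \<delta>"
      using analytic_continuation'[OF hr(1) open_R connected_R, of "ball z0 \<delta>" z0] \<delta> z0 False
      by (auto simp: islimpt_ball)
    \<comment> \<open>By Hurwitz's theorem the value \<open>h z0\<close> of a nonconstant limit is
      attained on the ball by arbitrarily late iterates.\<close>
    have hit: "\<exists>j\<ge>J. \<exists>z\<in>ball z0 \<delta>. (G ^^ Suc (r j)) z = h z0" for J
    proof (rule ccontr)
      assume "\<not> ?thesis"
      then have nz: "(G ^^ Suc (r (n + J))) z - h z0 \<noteq> 0" if "z \<in> ball z0 \<delta>" for n z
        using that by auto
      have "h z0 - h z0 \<noteq> 0"
      proof (rule Hurwitz_no_zeros[of "ball z0 \<delta>" "\<lambda>n z. (G ^^ Suc (r (n + J))) z - h z0" "\<lambda>z. h z - h z0"])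
        show "(\<lambda>z. (G ^^ Suc (r (n + J))) z - h z0) holomorphic_on ball z0 \<delta>" for n
          using hol_R[of "Suc (r (n + J))"] \<delta>
          by (intro holomorphic_intros) (auto intro: holomorphic_on_subset simp del: funpow.simps)
        show "(\<lambda>z. h z - h z0) holomorphic_on ball z0 \<delta>"
          using hr(1) \<delta> by (intro holomorphic_intros) (auto intro: holomorphic_on_subset)
        show "uniform_limit K (\<lambda>n z. (G ^^ Suc (r (n + J))) z - h z0) (\<lambda>z. h z - h z0) sequentially"
          if K: "compact K" "K \<subseteq> ball z0 \<delta>" for K
        proof -
          have "uniform_limit K ((\<lambda>k. G ^^ Suc k) \<circ> r) h sequentially"
            using hr(3) K \<delta> by blast
          moreover have "filterlim (\<lambda>n. n + J) sequentially sequentially"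
            by (intro filterlim_subseq) (simp add: strict_mono_def)
          ultimately have "uniform_limit K (\<lambda>n. ((\<lambda>k. G ^^ Suc k) \<circ> r) (n + J)) h sequentially"
            by (rule filterlim_compose)
          then show ?thesis
            by (intro uniform_limit_intros) (simp add: o_def)
        qed
        show "\<not> (\<lambda>z. h z - h z0) constant_on ball z0 \<delta>"
          using nonconst by (auto simp: constant_on_def) (metis diff_add_cancel)
      qed (use nz \<delta> in \<open>auto simp del: funpow.simps\<close>)
      then show False
        by simp
    qed
    obtain j1 z1 where j1: "z1 \<in> ball z0 \<delta>" "(G ^^ Suc (r j1)) z1 = h z0"
      using hit by blast
    obtain j2 z2 where j2: "j2 \<ge> Suc j1" "z2 \<in> ball z0 \<delta>" "(G ^^ Suc (r j2)) z2 = h z0"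
      using hit by blast
    have "r j1 < r j2"
      using hr(2) j2(1) by (simp add: strict_mono_def)
    then obtain d where "r j2 = r j1 + Suc d"
      using less_imp_Suc_add by (metis add_Suc_right)
    then have "Suc (r j2) = Suc (r j1) + Suc d"
      by simp
    \<comment> \<open>Cancelling the shorter of the two iterates by injectivity, a positive iterate
      takes \<open>z2\<close> to \<open>z1\<close>, so \<open>z1\<close> would lie in
      \<open>D\<close>.\<close>
    then have "(G ^^ Suc (r j1)) ((G ^^ Suc d) z2) = (G ^^ Suc (r j1)) z1"
      using j1(2) j2(3) by (metis comp_apply funpow_add)
    moreover have zY: "z1 \<in> Y" "z2 \<in> Y"
      using j1 j2 \<delta> R_Y by blast+
    ultimately have "(G ^^ Suc d) z2 = z1"
      using inj_onD[OF inj_Gk] Gk_Y by blast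
    then have "z1 \<in> D"
      using Gk_D[OF zY(2), of d] by simp
    moreover have "z1 \<in> Ou s"
      using j1 \<delta> by blast
    ultimately show False
      using side_disjoint(3)[of s] by blast
  qed
qed

lemma (in ring_cycle) no_ring_cycle: False
proof -
  obtain s where s: "b \<in> I s" "\<And>t. b \<in> I t \<Longrightarrow> I t \<subseteq> I s"
    using outermost_exists by blast
  define N where "N = (LEAST k. I (s + k) \<inter> P \<noteq> {})"
  have N: "I (s + N) \<inter> P \<noteq> {}"
    unfolding N_def using pole_inside by (rule LeastI_ex)
  have N': "I (s + r) \<inter> P = {}" if "r < N" for r
    using not_less_Least[of r "\<lambda>k. I (s + k) \<inter> P \<noteq> {}"] that unfolding N_def by blast
  interpret ring_cycle_outermost f b \<gamma> R q C I Ou s N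
    by unfold_locales (use s N N' in \<open>auto simp: I_def C_def\<close>)
  show False
    by (rule no_outermost_curve)
qed

section \<open>Absence of Herman rings\<close>

text \<open>\<open>V\<close> and its forward images form a \<open>ring_cycle\<close>, the invariant
  curves being the images of one circle in the ring coordinate.\<close>

lemma (in meromorphic_omitting) no_herman_ring: "\<not> herman_ring f V"
proof
  assume "herman_ring f V"

  \<comment> \<open>The ring and its uniformizing coordinate\<close>
  then obtain p \<phi> r \<theta> where V: "fatou_component f V" and p: "p > 0" "(f ^^ p) ` V \<subseteq> V"
    and \<theta>: "\<theta> \<notin> \<rat>" and \<phi>: "\<phi> holomorphic_on V"
      "bij_betw \<phi> V {w. 1 < cmod w \<and> cmod w < r}" and r: "r > 1"
    and conj: "\<And>w. 1 < cmod w \<Longrightarrow> cmod w < r \<Longrightarrow>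
        \<phi> ((f ^^ p) (inv_into V \<phi> w)) = exp (2 * pi * \<i> * of_real \<theta>) * w"
    unfolding herman_ring_def by blast
  define A where "A = {w. 1 < cmod w \<and> cmod w < r}"
  define u where "u = exp (2 * pi * \<i> * of_real \<theta>)"
  have u: "cmod u = 1"
    by (simp add: u_def norm_exp_eq_Re)
  obtain z0 where z0: "z0 \<in> fatou_set f" "V = connected_component_set (fatou_set f) z0"
    using V by (auto simp: fatou_component_def)
  have oV: "open V" and cV: "connected V" and VF: "V \<subseteq> fatou_set f" and V0: "z0 \<in> V"
    using z0 open_fatou by (auto simp: open_connected_component connected_component_subset
        connected_component_refl_eq)
  have V_max: "U \<subseteq> V" if U: "connected U" "U \<subseteq> fatou_set f" "U \<inter> V \<noteq> {}" for U
  proof -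
    obtain x where "x \<in> U" "x \<in> V"
      using U(3) by blast
    then have "connected_component_set (fatou_set f) x = V"
      using z0 by (metis connected_component_eq)
    then show ?thesis
      using connected_component_maximal[OF \<open>x \<in> U\<close> U(1,2)] by simp
  qed
  have no_pole: "(f ^^ k) z \<notin> P" if "z \<in> V" for k z
    using that VF fatou_pole_free by blast
  have hol: "(f ^^ k) holomorphic_on V" for k
    using no_pole by (intro holomorphic_iterate)
  have bij: "bij_betw \<phi> V A"
    using \<phi> by (simp add: A_def)
  then have inj_\<phi>: "inj_on \<phi> V" and \<phi>V: "\<phi> ` V = A"
    by (auto simp: bij_betw_def)
  define \<psi> where "\<psi> = inv_into V \<phi>"
  have \<psi>: "\<psi> w \<in> V" "\<phi> (\<psi> w) = w" if "w \<in> A" for w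
    using that unfolding \<psi>_def \<phi>V[symmetric] by (auto intro: inv_into_into f_inv_into_f)
  have \<psi>\<phi>: "\<psi> (\<phi> z) = z" if "z \<in> V" for z
    unfolding \<psi>_def using inj_\<phi> that by (rule inv_into_f_f)
  have \<phi>A: "\<phi> z \<in> A" if "z \<in> V" for z
    using that \<phi>V by blast
  have hol_\<psi>: "\<psi> holomorphic_on A"
  proof -
    obtain \<psi>' where \<psi>': "\<psi>' holomorphic_on \<phi> ` V" "\<And>z. z \<in> V \<Longrightarrow> \<psi>' (\<phi> z) = z"
      using holomorphic_has_inverse[OF \<phi>(1) oV inj_\<phi>] by metis
    show ?thesis
      using \<psi>'(1) unfolding \<phi>V
      by (rule holomorphic_transform) (metis \<psi> \<psi>'(2))
  qed
  have oA: "open A" and cA: "connected A"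
    unfolding \<phi>V[symmetric] using \<phi> oV cV inj_\<phi>
    by (auto intro: open_mapping_thm3 connected_continuous_image holomorphic_on_imp_continuous_on)
  have A0: "w \<noteq> 0" if "w \<in> A" for w
    using that by (auto simp: A_def)
  have A_rot: "x * w \<in> A" if "w \<in> A" "cmod x = 1" for x w
    using that by (simp add: A_def norm_mult)
  have fp: "(f ^^ p) z \<in> V" "\<phi> ((f ^^ p) z) = u * \<phi> z" if "z \<in> V" for z
    using p(2) that conj[of "\<phi> z"] \<phi>A[OF that] \<psi>\<phi>[OF that] by (auto simp: A_def u_def \<psi>_def)
  have fpk: "(f ^^ (p * k)) z \<in> V \<and> \<phi> ((f ^^ (p * k)) z) = u ^ k * \<phi> z" if "z \<in> V" for z k
    using that
  proof (induction k)
    case (Suc k)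
    have "(f ^^ (p * Suc k)) z = (f ^^ p) ((f ^^ (p * k)) z)"
      by (simp add: funpow_add)
    then show ?case
      using Suc fp by simp
  qed simp
  \<comment> \<open>\<open>f ^^ (p * k)\<close> is a rotation in the coordinate \<phi> and factors
    through \<open>f ^^ k\<close>.\<close>
  have inj_f: "inj_on (f ^^ k) V" for k
  proof -
    have "inj_on (f ^^ (p * k)) V"
    proof (rule inj_onI)
      fix x y assume xy: "x \<in> V" "y \<in> V" "(f ^^ (p * k)) x = (f ^^ (p * k)) y"
      have "u \<noteq> 0"
        by (simp add: u_def)
      then have "\<phi> x = \<phi> y"
        using xy fpk[of x k] fpk[of y k] by (metis mult_left_cancel power_not_zero)
      then show "x = y"
        using inj_\<phi> xy by (auto simp: inj_on_def)
    qed
    moreover have "f ^^ (p * k) = (f ^^ (p * k - k)) \<circ> (f ^^ k)"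
      using p(1) by (simp flip: funpow_add)
    ultimately show ?thesis
      by (metis inj_on_imageI2)
  qed
  have nonconst: "\<not> g constant_on UNIV"
  proof
    assume "g constant_on UNIV"
    then obtain c where "\<And>z. g z = c"
      by (auto simp: constant_on_def)
    then have "f z = b + 1 / c" if "z \<in> V" for z
      using f_eq_g[of z] no_pole[OF that, of 0] by simp
    then have "f constant_on V"
      by (auto simp: constant_on_def)
    then show False
      using injective_not_constant[OF oV, of f] inj_f[of 1] V0 by auto
  qed
  have fF: "(f ^^ k) z \<in> fatou_set f" if "z \<in> fatou_set f" for k z
    using that fatou_forward[OF nonconst] by (induction k) auto
  have conn_f: "connected ((f ^^ k) ` X)" if "connected X" "X \<subseteq> V" for k X
    using that hol holomorphic_on_subset
    by (intro connected_continuous_image holomorphic_on_imp_continuous_on) blast+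

  \<comment> \<open>\<open>p\<close> is just some period; the first return time is what makes the
    \<open>q\<close> rings of the cycle disjoint.\<close>
  define q where "q = (LEAST k. k > 0 \<and> (f ^^ k) ` V \<inter> V \<noteq> {})"
  have "p > 0 \<and> (f ^^ p) ` V \<inter> V \<noteq> {}"
    using p V0 by blast
  then have q: "q > 0" "(f ^^ q) ` V \<inter> V \<noteq> {}"
    unfolding q_def by (metis (mono_tags, lifting) LeastI)+
  have q_least: "(f ^^ k) ` V \<inter> V = {}" if "0 < k" "k < q" for k
    using not_less_Least[of k "\<lambda>k. k > 0 \<and> (f ^^ k) ` V \<inter> V \<noteq> {}"] that unfolding q_def by blast
  have qV: "(f ^^ q) ` V \<subseteq> V"
  proof (rule V_max)
    show "(f ^^ q) ` V \<subseteq> fatou_set f"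
      using VF fF by blast
  qed (use q conn_f cV in auto)

  \<comment> \<open>The first return map as a rotation\<close>
  define h where "h w = \<phi> ((f ^^ q) (\<psi> w)) / w" for w
  have "h holomorphic_on A"
  proof -
    have "(f ^^ q \<circ> \<psi>) holomorphic_on A"
      using \<psi> by (intro holomorphic_on_compose_gen[OF hol_\<psi> hol]) auto
    then have "\<phi> \<circ> (f ^^ q \<circ> \<psi>) holomorphic_on A"
      using \<psi> qV by (intro holomorphic_on_compose_gen[OF _ \<phi>(1)]) auto
    then show ?thesis
      unfolding h_def[abs_def] using A0 by (intro holomorphic_intros) (auto simp: o_def)
  qed
  \<comment> \<open>The first return \<open>f ^^ q\<close> commutes with the irrational rotation \<open>f ^^ p\<close>, so it is a rotation too.\<close>
  have h_rot: "h (u * w) = h w" if w: "w \<in> A" for w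
  proof -
    have "\<phi> ((f ^^ p) (\<psi> w)) = u * w"
      using fp(2)[of "\<psi> w"] \<psi> w by simp
    then have "\<psi> (u * w) = (f ^^ p) (\<psi> w)"
      using \<psi>\<phi>[of "(f ^^ p) (\<psi> w)"] fp(1) \<psi>(1)[OF w] by metis
    then have "(f ^^ q) (\<psi> (u * w)) = (f ^^ p) ((f ^^ q) (\<psi> w))"
      by (metis add.commute comp_apply funpow_add)
    moreover have "(f ^^ q) (\<psi> w) \<in> V"
      using qV \<psi>(1)[OF w] by blast
    ultimately show ?thesis
      using fp(2) by (simp add: h_def u_def)
  qed
  have h_pow: "h (u ^ k * w) = h w" if "w \<in> A" for k w
    using that
  proof (induction k)
    case (Suc k)
    have "u ^ k * w \<in> A"
      using Suc.prems A_rot u by (simp add: norm_power)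
    then show ?case
      using h_rot[of "u ^ k * w"] Suc by (simp add: mult.assoc)
  qed simp
  have inj_u: "inj (\<lambda>k. u ^ k)"
  proof (rule injI)
    fix j k :: nat assume "u ^ j = u ^ k"
    then have "exp (of_nat j * (2 * pi * \<i> * of_real \<theta>)) = exp (of_nat k * (2 * pi * \<i> * of_real \<theta>))"
      by (simp only: u_def exp_of_nat_mult)
    then obtain n :: int where "of_nat j * (2 * pi * \<i> * of_real \<theta>) =
        of_nat k * (2 * pi * \<i> * of_real \<theta>) + (of_int (2 * n) * pi) * \<i>"
      unfolding exp_eq by blast
    then have "2 * pi * (real j * \<theta>) = 2 * pi * (real k * \<theta> + of_int n)"
      by (simp add: complex_eq_iff algebra_simps)
    then have "real j * \<theta> = real k * \<theta> + of_int n"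
      by (subst (asm) mult_left_cancel) auto
    then have n: "(real j - real k) * \<theta> = of_int n"
      by (simp add: left_diff_distrib)
    show "j = k"
    proof (rule ccontr)
      assume "j \<noteq> k"
      then have "\<theta> = of_int n / (real j - real k)"
        using n by (simp add: field_simps)
      also have "\<dots> \<in> \<rat>"
        by simp
      finally show False
        using \<theta> by simp
    qed
  qed
  define \<rho> where "\<rho> = (1 + r) / 2"
  have \<rho>: "1 < \<rho>" "\<rho> < r"
    using r by (auto simp: \<rho>_def)
  have sphere_A: "sphere 0 t \<subseteq> A" if "1 < t" "t < r" for t
    using that by (auto simp: A_def)
  \<comment> \<open>The orbit of \<rho> under the irrational rotation is infinite on a compact
    circle and so accumulates in \<open>A\<close>; \<open>h\<close> is constant along it, and the
    identity theorem applies.\<close>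
  have "h constant_on A"
  proof -
    let ?U = "range (\<lambda>k. u ^ k * of_real \<rho>)"
    have "inj (\<lambda>k. u ^ k * of_real \<rho>)"
      using inj_u \<rho> by (auto simp: inj_on_def)
    then have "infinite ?U"
      by (rule range_inj_infinite)
    moreover have US: "?U \<subseteq> sphere 0 \<rho>"
      using u \<rho> by (auto simp: norm_mult norm_power)
    ultimately obtain \<xi> where \<xi>: "\<xi> \<in> sphere 0 \<rho>" "\<xi> islimpt ?U"
      using compact_sphere[of 0 \<rho>] by (auto simp: compact_eq_Bolzano_Weierstrass)
    have \<rho>A: "of_real \<rho> \<in> A"
      using \<rho> by (auto simp: A_def)
    show ?thesis
    proof (rule analytic_continuation'[OF \<open>h holomorphic_on A\<close> oA cA _ _ \<xi>(2)])
      show "h constant_on ?U"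
        unfolding constant_on_def using h_pow[OF \<rho>A] by auto
    qed (use US \<xi>(1) sphere_A[OF \<rho>] in blast)+
  qed
  then obtain c where hc: "\<And>w. w \<in> A \<Longrightarrow> h w = c"
    by (auto simp: constant_on_def)
  then have fq: "\<phi> ((f ^^ q) z) = c * \<phi> z" if "z \<in> V" for z
    using hc[OF \<phi>A[OF that]] A0[OF \<phi>A[OF that]] \<psi>\<phi>[OF that] by (simp add: h_def field_simps)
  have fqk: "(f ^^ (q * k)) z \<in> V \<and> \<phi> ((f ^^ (q * k)) z) = c ^ k * \<phi> z" if "z \<in> V" for z k
    using that
  proof (induction k)
    case (Suc k)
    have "(f ^^ (q * Suc k)) z = (f ^^ q) ((f ^^ (q * k)) z)"
      by (simp add: funpow_add)
    then show ?case
      using Suc fq qV by auto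
  qed simp
  \<comment> \<open>\<open>f ^^ (p * q)\<close> acts as multiplication by \<open>c ^ p\<close> and
    also by \<open>u ^ q\<close>, which has modulus 1.\<close>
  have c: "cmod c = 1"
  proof -
    have "c ^ p * \<phi> z0 = \<phi> ((f ^^ (p * q)) z0)"
      using fqk[OF V0, of p] by (simp add: mult.commute[of q p])
    also have "\<dots> = u ^ q * \<phi> z0"
      using fpk[OF V0, of q] by simp
    finally have "c ^ p * \<phi> z0 = u ^ q * \<phi> z0" .
    then have "c ^ p = u ^ q"
      using A0[OF \<phi>A[OF V0]] by simp
    then have "cmod c ^ p = 1"
      using u by (metis norm_power power_one)
    then show ?thesis
      using p(1) power_eq_imp_eq_base[of "cmod c" p 1] by simp
  qed
  have surj_qk: "\<exists>v\<in>V. (f ^^ (q * k)) v = y \<and> cmod (\<phi> v) = cmod (\<phi> y)" if y: "y \<in> V" for y k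
  proof
    let ?w = "inverse c ^ k * \<phi> y"
    have w: "?w \<in> A"
      using \<phi>A[OF y] c by (intro A_rot) (auto simp: norm_power norm_inverse)
    then show v: "\<psi> ?w \<in> V"
      by (rule \<psi>)
    have "c \<noteq> 0"
      using c by auto
    then have "\<phi> ((f ^^ (q * k)) (\<psi> ?w)) = \<phi> y"
      using fqk[OF v, of k] \<psi>(2)[OF w] by (simp add: field_simps)
    then have "(f ^^ (q * k)) (\<psi> ?w) = y"
      using inj_onD[OF inj_\<phi>] fqk[OF v] y by blast
    moreover have "cmod (\<phi> (\<psi> ?w)) = cmod (\<phi> y)"
      using \<psi>(2)[OF w] c by (simp add: norm_mult norm_power norm_inverse)
    ultimately show "(f ^^ (q * k)) (\<psi> ?w) = y \<and> cmod (\<phi> (\<psi> ?w)) = cmod (\<phi> y)"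
      by simp
  qed

  \<comment> \<open>The cycle of rings and its invariant curves\<close>
  define S where "S t = {v \<in> V. cmod (\<phi> v) = t}" for t
  have S_eq: "S t = \<psi> ` sphere 0 t" if "1 < t" "t < r" for t
    using sphere_A[OF that] \<psi> \<psi>\<phi> by (force simp: S_def image_iff)
  have S_q: "(f ^^ (q * k)) ` S t = S t" for k t
  proof
    show "(f ^^ (q * k)) ` S t \<subseteq> S t"
      using fqk c by (auto simp: S_def norm_mult norm_power)
    show "S t \<subseteq> (f ^^ (q * k)) ` S t"
    proof
      fix y assume "y \<in> S t"
      then have "y \<in> V" "cmod (\<phi> y) = t"
        by (auto simp: S_def)
      then show "y \<in> (f ^^ (q * k)) ` S t"
        using surj_qk[of y k] by (auto simp: S_def image_iff)
    qed
  qed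
  have V_q: "(f ^^ (q * k)) ` V = V" for k
    using fqk surj_qk by (auto simp: image_iff) (metis)
  define \<gamma> where "\<gamma> i = (f ^^ i \<circ> \<psi>) \<circ> circlepath 0 \<rho>" for i
  define R where "R i = (f ^^ i) ` V" for i
  have pim: "path_image (\<gamma> i) = (f ^^ i) ` S \<rho>" for i
    using \<rho> by (simp add: \<gamma>_def path_image_compose S_eq image_comp)
  have hol': "(f ^^ i \<circ> \<psi>) holomorphic_on A" for i
    using \<psi> by (intro holomorphic_on_compose_gen[OF hol_\<psi> hol]) auto
  have pow_image: "(f ^^ j) ` (f ^^ i) ` X = (f ^^ (i + j)) ` X" for i j X
    by (metis add.commute funpow_add image_comp)
  \<comment> \<open>These further steps complete \<open>i\<close> steps to a multiple of the period,
    so \<open>f ^^ m i\<close> brings \<open>R i\<close> back to \<open>V\<close>. As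
    \<open>q > 0\<close>, the truncated subtraction is exact.\<close>
  define m where "m i = q * i - i" for i
  have m: "i + m i = q * i" for i
    using q(1) by (simp add: m_def)
  have fm: "(f ^^ m i) ((f ^^ i) z) = (f ^^ (q * i)) z" for i z
    by (metis m add.commute comp_apply funpow_add)
  have inj_fm: "inj_on (f ^^ m i) (R i)" for i
    unfolding R_def
  proof (intro inj_onI, clarify)
    fix x y assume "x \<in> V" "y \<in> V" "(f ^^ m i) ((f ^^ i) x) = (f ^^ m i) ((f ^^ i) y)"
    then have "x = y"
      using inj_onD[OF inj_f[of "q * i"]] by (simp add: fm)
    then show "(f ^^ i) x = (f ^^ i) y"
      by simp
  qed
  have oR: "open (R i)" for i
    unfolding R_def using hol oV inj_f by (rule open_mapping_thm3)
  have RF: "R i \<subseteq> fatou_set f" for i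
    unfolding R_def using VF fF by blast
  have R_add: "R (i + q) = R i" for i
    using V_q[of 1] pow_image[of i q V] pow_image[of q i V] by (simp add: R_def add.commute)
  have R_mod: "R i = R (i mod q)" for i
  proof -
    have "R (j + k * q) = R j" for j k
    proof (induction k)
      case (Suc k)
      then show ?case
        using R_add[of "j + k * q"] by (simp add: add_ac)
    qed simp
    then show ?thesis
      by (metis mod_div_mult_eq)
  qed
  \<comment> \<open>A common point would lead from \<open>V\<close> back to \<open>V\<close> after
    \<open>q - j + i\<close> steps, a time strictly between 0 and \<open>q\<close>.\<close>
  have R_disj: "R i \<inter> R j = {}" if "i < j" "j < q" for i j
  proof (rule ccontr)
    assume "R i \<inter> R j \<noteq> {}"
    then obtain v w where vw: "v \<in> V" "w \<in> V" "(f ^^ i) v = (f ^^ j) w"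
      by (auto simp: R_def)
    have "(f ^^ (q - j + i)) v = (f ^^ (q - j)) ((f ^^ j) w)"
      using vw(3) by (simp add: funpow_add)
    also have "\<dots> = (f ^^ q) w"
      using that by (metis comp_apply funpow_add le_add_diff_inverse2 less_imp_le)
    finally have "(f ^^ (q - j + i)) v \<in> V"
      using qV vw by auto
    then have mem: "(f ^^ (q - j + i)) v \<in> (f ^^ (q - j + i)) ` V \<inter> V"
      using vw(1) by (intro IntI imageI)
    have "(f ^^ (q - j + i)) ` V \<inter> V = {}"
      using that by (intro q_least) auto
    with mem show False
      by (simp only: empty_iff)
  qed
  have phi_m: "cmod (\<phi> ((f ^^ m i) ((f ^^ i) v))) = cmod (\<phi> v)" "(f ^^ m i) ((f ^^ i) v) \<in> V"
    if "v \<in> V" for v i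
    using fqk[OF that, of i] c by (simp_all add: fm norm_mult norm_power)

  \<comment> \<open>Verification of the assumptions on the cycle\<close>
  interpret ring_cycle f b \<gamma> R q "\<lambda>i. path_image (\<gamma> i)" "\<lambda>i. inside (path_image (\<gamma> i))"
      "\<lambda>i. outside (path_image (\<gamma> i))"
  proof unfold_locales
    fix i
    show "valid_path (\<gamma> i)"
      unfolding \<gamma>_def using sphere_A \<rho> by (intro valid_path_compose_holomorphic[OF _ hol' oA]) auto
    show "simple_path (\<gamma> i)"
      unfolding \<gamma>_def
    proof (rule simple_path_comp_injective)
      show "simple_path (circlepath 0 \<rho>)"
        using \<rho> by (simp add: simple_path_circlepath)
      show "continuous_on (path_image (circlepath 0 \<rho>)) (f ^^ i \<circ> \<psi>)"
        using hol' sphere_A \<rho> by (intro holomorphic_on_imp_continuous_on) (auto intro: holomorphic_on_subset)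
      have "inj_on \<psi> A"
        using \<psi>(2) by (metis inj_onI)
      then have "inj_on (f ^^ i \<circ> \<psi>) A"
        using inj_on_subset[OF inj_f, of "\<psi> ` A" i] \<psi>(1) by (intro comp_inj_on) auto
      then show "inj_on (f ^^ i \<circ> \<psi>) (path_image (circlepath 0 \<rho>))"
        by (rule inj_on_subset) (use sphere_A \<rho> in auto)
    qed
    show "pathfinish (\<gamma> i) = pathstart (\<gamma> i)"
      by (simp add: \<gamma>_def pathfinish_compose pathstart_compose)
    show "path_image (\<gamma> i) \<subseteq> R i"
      by (auto simp: pim R_def S_def)
    show "connected (R i)"
      unfolding R_def using cV conn_f by blast
    show "closure (R i) \<inter> fatou_set f \<subseteq> R i"
    proof
      fix x assume x: "x \<in> closure (R i) \<inter> fatou_set f"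
      \<comment> \<open>\<open>R i\<close> is not yet known to be a full Fatou component, so the
        adherent point is first carried to \<open>V\<close>, which is one.\<close>
      let ?y = "(f ^^ m i) x"
      have cont: "continuous_on (fatou_set f) (f ^^ m i)"
        using fatou_pole_free by (intro holomorphic_on_imp_continuous_on holomorphic_iterate)
      have op: "open (fatou_set f \<inter> (f ^^ m i) -` U)" if "open U" for U
        using continuous_open_preimage[OF cont open_fatou that] .
      have "?y \<in> closure V"
        unfolding closure_iff_nhds_not_empty
      proof (intro allI impI)
        fix B U assume U: "U \<subseteq> B" "open U" "?y \<in> U"
        have "x \<in> closure (R i) \<inter> (fatou_set f \<inter> (f ^^ m i) -` U)"
          using x U by simp
        then have "R i \<inter> (fatou_set f \<inter> (f ^^ m i) -` U) \<noteq> {}"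
          using open_Int_closure_eq_empty[OF op[OF U(2)], of "R i"] by blast
        then show "V \<inter> B \<noteq> {}"
          using phi_m(2) U(1) by (auto simp: R_def)
      qed
      moreover have "?y \<in> fatou_set f"
        using x fF by blast
      ultimately have "?y \<in> V"
        using V_max[of "insert ?y V"] connected_intermediate_closure[OF cV, of "insert ?y V"]
          closure_subset[of V] VF V0 by blast
      then obtain v where v: "v \<in> V" "(f ^^ (q * i)) v = ?y"
        using surj_qk by blast
      \<comment> \<open>The ring point with the same image as \<open>x\<close>. Were it different,
        points of \<open>R i\<close> near \<open>x\<close> would share images with points of
        \<open>R i\<close> near \<open>x'\<close>, against injectivity.\<close>
      define x' where "x' = (f ^^ i) v"
      have x': "x' \<in> R i" "(f ^^ m i) x' = ?y"
        using v by (auto simp: x'_def R_def fm)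
      show "x \<in> R i"
      proof (rule ccontr)
        assume "x \<notin> R i"
        then have "x \<noteq> x'"
          using x' by auto
        then obtain U U' where U: "open U" "open U'" "x \<in> U" "x' \<in> U'" "U \<inter> U' = {}"
          by (metis hausdorff)
        define B where "B = U' \<inter> R i"
        have "open ((f ^^ m i) ` B)"
        proof (rule open_mapping_thm3)
          show "(f ^^ m i) holomorphic_on B"
            using RF fatou_pole_free unfolding B_def by (intro holomorphic_iterate) blast
          show "inj_on (f ^^ m i) B"
            using inj_on_subset[OF inj_fm] by (auto simp: B_def)
        qed (use U oR in \<open>auto simp: B_def\<close>)
        then have "open (U \<inter> (fatou_set f \<inter> (f ^^ m i) -` (f ^^ m i) ` B))"
          using U(1) op by blast
        moreover have "x \<in> U \<inter> (fatou_set f \<inter> (f ^^ m i) -` (f ^^ m i) ` B)"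
          using U x x' by (auto simp: B_def image_iff intro!: bexI[of _ x'])
        ultimately have "R i \<inter> (U \<inter> (fatou_set f \<inter> (f ^^ m i) -` (f ^^ m i) ` B)) \<noteq> {}"
          using open_Int_closure_eq_empty[of _ "R i"] x by blast
        then obtain z z' where "z \<in> R i" "z \<in> U" "z' \<in> B" "(f ^^ m i) z = (f ^^ m i) z'"
          by auto
        then have "z = z'"
          using inj_onD[OF inj_fm, of i z z'] by (auto simp: B_def)
        then show False
          using \<open>z \<in> U\<close> \<open>z' \<in> B\<close> U(5) by (auto simp: B_def)
      qed
    qed
    show "R i \<inter> R j = {}" if "i mod q \<noteq> j mod q" for j
      using R_disj[of "i mod q" "j mod q"] R_disj[of "j mod q" "i mod q"] that q(1)
        R_mod[of i] R_mod[of j] by (metis inf_commute linorder_neqE_nat mod_less_divisor)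
    show "path_image (\<gamma> (i + q)) = path_image (\<gamma> i)"
      using S_q[of 1 \<rho>] pow_image[of i q "S \<rho>"] by (simp add: pim add.commute)
    show "f ` path_image (\<gamma> i) = path_image (\<gamma> (Suc i))"
      using pow_image[of 1 i "S \<rho>"] pow_image[of i 1 "S \<rho>"] by (simp add: pim)
    show "inj_on f (path_image (\<gamma> i))"
      unfolding pim
    proof (intro inj_onI, clarify)
      fix x y assume "x \<in> S \<rho>" "y \<in> S \<rho>" "f ((f ^^ i) x) = f ((f ^^ i) y)"
      then have "x = y"
        using inj_onD[OF inj_f[of "Suc i"], of x y] by (auto simp: S_def)
      then show "(f ^^ i) x = (f ^^ i) y"
        by simp
    qed
    have C_iff: "z \<in> path_image (\<gamma> i) \<longleftrightarrow> cmod (\<phi> ((f ^^ m i) z)) = \<rho>" if z: "z \<in> R i" for z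
    proof -
      obtain v where v: "v \<in> V" "z = (f ^^ i) v"
        using z by (auto simp: R_def)
      have "z \<in> path_image (\<gamma> i) \<longleftrightarrow> v \<in> S \<rho>"
        unfolding pim v(2) using v(1) inj_onD[OF inj_f[of i]] by (auto simp: S_def)
      then show ?thesis
        using phi_m(1)[OF v(1), of i] v by (simp add: S_def)
    qed
    \<comment> \<open>The maximum principle for \<phi> after \<open>f ^^ m i\<close> and for its
      reciprocal would force modulus \<rho> at an inside point, placing it on the curve.\<close>
    show "\<not> inside (path_image (\<gamma> i)) \<subseteq> R i"
    proof
      let ?I = "inside (path_image (\<gamma> i))"
      assume sub: "?I \<subseteq> R i"
      note J = Jordan_inside_outside[OF \<open>simple_path (\<gamma> i)\<close> \<open>pathfinish (\<gamma> i) = pathstart (\<gamma> i)\<close>]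
      have clR: "closure ?I \<subseteq> R i"
        unfolding closure_Un_frontier using J sub \<open>path_image (\<gamma> i) \<subseteq> R i\<close> by simp
      have holR: "\<phi> \<circ> (f ^^ m i) holomorphic_on R i"
      proof (rule holomorphic_on_compose_gen[OF _ \<phi>(1)])
        show "(f ^^ m i) holomorphic_on R i"
          using RF fatou_pole_free by (intro holomorphic_iterate) blast
        show "(f ^^ m i) ` R i \<subseteq> V"
          using phi_m(2) by (auto simp: R_def)
      qed
      have nz: "\<phi> ((f ^^ m i) z) \<noteq> 0" if "z \<in> R i" for z
        using that A0[OF \<phi>A[OF phi_m(2)]] by (auto simp: R_def)
      have holR': "(\<lambda>z. 1 / \<phi> ((f ^^ m i) z)) holomorphic_on R i"
        using holR nz by (intro holomorphic_intros) (auto simp: o_def)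
      obtain \<xi> where \<xi>: "\<xi> \<in> ?I"
        using J by blast
      have fr: "cmod (\<phi> ((f ^^ m i) z)) = \<rho>" if "z \<in> frontier ?I" for z
        using that J C_iff[of z] \<open>path_image (\<gamma> i) \<subseteq> R i\<close> by auto
      have "cmod ((\<phi> \<circ> (f ^^ m i)) \<xi>) \<le> \<rho>"
      proof (rule maximum_modulus_frontier[of "\<phi> \<circ> (f ^^ m i)" ?I])
        show "\<phi> \<circ> (f ^^ m i) holomorphic_on interior ?I"
          using holR sub interior_subset by (meson holomorphic_on_subset order_trans)
        show "continuous_on (closure ?I) (\<phi> \<circ> (f ^^ m i))"
          using holR clR by (meson continuous_on_subset holomorphic_on_imp_continuous_on)
      qed (use J fr \<xi> in auto)
      moreover have "cmod ((\<lambda>z. 1 / \<phi> ((f ^^ m i) z)) \<xi>) \<le> 1 / \<rho>"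
      proof (rule maximum_modulus_frontier[of "\<lambda>z. 1 / \<phi> ((f ^^ m i) z)" ?I])
        show "(\<lambda>z. 1 / \<phi> ((f ^^ m i) z)) holomorphic_on interior ?I"
          using holR' sub interior_subset by (meson holomorphic_on_subset order_trans)
        show "continuous_on (closure ?I) (\<lambda>z. 1 / \<phi> ((f ^^ m i) z))"
          using holR' clR by (meson continuous_on_subset holomorphic_on_imp_continuous_on)
      qed (use J fr \<xi> in \<open>auto simp: norm_divide\<close>)
      ultimately have "cmod (\<phi> ((f ^^ m i) \<xi>)) = \<rho>"
        using nz[of \<xi>] \<xi> sub \<rho> by (auto simp: norm_divide field_simps)
      then have "\<xi> \<in> path_image (\<gamma> i)"
        using C_iff \<xi> sub by blast
      then show False
        using \<xi> inside_no_overlap by blast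
    qed
    \<comment> \<open>The witness is the image of the concentric circle through the coordinate of
      the point; the return map preserves it.\<close>
    show "\<exists>L. connected L \<and> L \<inter> path_image (\<gamma> i) = {} \<and> z \<in> L \<and> (f ^^ (q * k)) z \<in> L"
      if z: "z \<in> R i" "z \<notin> path_image (\<gamma> i)" for z k
    proof -
      obtain v where v: "v \<in> V" "z = (f ^^ i) v"
        using z by (auto simp: R_def)
      define t where "t = cmod (\<phi> v)"
      have t: "1 < t" "t < r"
        using \<phi>A[OF v(1)] by (auto simp: A_def t_def)
      have "t \<noteq> \<rho>"
        using z v by (auto simp: pim S_def t_def)
      have "connected (S t)"
        unfolding S_eq[OF t] using hol_\<psi> sphere_A[OF t]
        by (intro connected_continuous_image holomorphic_on_imp_continuous_on)
          (auto intro: holomorphic_on_subset connected_sphere)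
      then have "connected ((f ^^ i) ` S t)"
        by (rule conn_f) (auto simp: S_def)
      moreover have "(f ^^ i) ` S t \<inter> path_image (\<gamma> i) = {}"
        unfolding pim using inj_onD[OF inj_f[of i]] \<open>t \<noteq> \<rho>\<close> by (auto simp: S_def)
      moreover have "v \<in> S t"
        using v by (simp add: S_def t_def)
      moreover from this have "(f ^^ (q * k)) v \<in> S t"
        using S_q[of k t] by blast
      moreover have "(f ^^ (q * k)) z = (f ^^ i) ((f ^^ (q * k)) v)"
        unfolding v(2) by (metis add.commute comp_apply funpow_add)
      ultimately show ?thesis
        using v(2) by (intro exI[of _ "(f ^^ i) ` S t"]) auto
    qed
  qed (use q(1) oR RF in auto)
  show False
    by (rule no_ring_cycle)
qed

theorem theorem1p2:
  fixes f :: "complex \<Rightarrow> complex" and J :: "(real \<times> real \<times> real) set"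
  assumes "class_MS f"
    and "julia_component f J"
  shows "finite {V. herman_ring f V \<and> (\<exists>C. boundary_component V C \<and> C \<subseteq> J)}"
proof -
  obtain b where "meromorphic_plane f" "omitted_value f b"
    using assms by (auto simp: class_MS_def general_transcendental_meromorphic_def
        transcendental_meromorphic_def stable_bov_def baker_omitted_value_def)
  then interpret meromorphic_omitting f b
    by unfold_locales
  show ?thesis
    using no_herman_ring by simp
qed

end
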